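(* There is no super-maximal pair of computably enumerable sets; that is, there are no computably enumerable sets $A, B \subseteq \omega$ that form a super-maximal pair.
   Context: For sets $X, Y \subseteq \omega$, write $X =^* Y$ if the symmetric difference of $X$ and $Y$ is finite, and $\overline{X} = \omega \setminus X$. A set $X$ is of c.e. degree if it is Turing equivalent to some computably enumerable set. Two computably enumerable sets $A$ and $B$ form a super-maximal pair if the following hold: (1) $A \cap B = \emptyset$; (2) $\omega \setminus (A \cup B)$ is infinite; and (3) whenever $X \subseteq \omega$ is of c.e. degree with $A \subseteq X$ and $B \subseteq \overline{X}$, then $X =^* A$ or $\overline{X} =^* B$. *)

theory Defs
  imports Main
begin

text \<open>
  Computability relative to an oracle set, by Kleene's partial recursive functions: programs are
  built from the basic functions and an oracle query by composition, primitive recursion and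
  unbounded search.
\<close>

datatype recf =
    Zero
  | Succ
  | Proj nat
  | Oracle
  | Comp recf "recf list"
  | PrimRec recf recf
  | Mu recf

text \<open>
  \<open>converges X p xs y\<close>: with oracle \<open>X\<close>, the program \<open>p\<close> converges on the argument tuple \<open>xs\<close> with
  value \<open>y\<close>. Programs carry no arity; on tuples of unsuitable length they simply diverge.
  \<open>Zero\<close> is the zero function of every arity.
\<close>

inductive converges :: "nat set \<Rightarrow> recf \<Rightarrow> nat list \<Rightarrow> nat \<Rightarrow> bool" for X :: "nat set" where
  converges_Zero: "converges X Zero xs 0"
| converges_Succ: "converges X Succ [x] (Suc x)"
| converges_Proj: "i < length xs \<Longrightarrow> converges X (Proj i) xs (xs ! i)"
| converges_Oracle: "converges X Oracle [x] (of_bool (x \<in> X))"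
| converges_Comp: "list_all2 (\<lambda>g y. converges X g xs y) gs ys \<Longrightarrow> converges X f ys z
    \<Longrightarrow> converges X (Comp f gs) xs z"
| converges_PrimRec_0: "converges X f xs y \<Longrightarrow> converges X (PrimRec f g) (0 # xs) y"
| converges_PrimRec_Suc: "converges X (PrimRec f g) (n # xs) r \<Longrightarrow> converges X g (n # r # xs) y
    \<Longrightarrow> converges X (PrimRec f g) (Suc n # xs) y"
| converges_Mu: "converges X f (n # xs) 0 \<Longrightarrow> (\<forall>m<n. \<exists>y. converges X f (m # xs) (Suc y))
    \<Longrightarrow> converges X (Mu f) xs n"

inductive_cases converges_ZeroE: "converges X Zero xs y"
inductive_cases converges_SuccE: "converges X Succ xs y"
inductive_cases converges_ProjE: "converges X (Proj i) xs y"
inductive_cases converges_OracleE: "converges X Oracle xs y"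
inductive_cases converges_CompE: "converges X (Comp f gs) xs y"
inductive_cases converges_PrimRec_0E: "converges X (PrimRec f g) (0 # xs) y"
inductive_cases converges_PrimRec_SucE: "converges X (PrimRec f g) (Suc n # xs) y"
inductive_cases converges_MuE: "converges X (Mu f) xs y"

text \<open>Programs compute partial functions.\<close>

lemma converges_deterministic: "converges X p xs y \<Longrightarrow> converges X p xs z \<Longrightarrow> y = z"
proof (induction arbitrary: z rule: converges.induct)
  case (converges_Comp xs gs ys f w)
  from converges_Comp.prems obtain ys' where
    ys': "list_all2 (\<lambda>g y. converges X g xs y) gs ys'" "converges X f ys' z"
    by (elim converges_CompE)
  have "ys = ys'"
  proof (rule nth_equalityI)
    show len: "length ys = length ys'"
      using list_all2_lengthD[OF converges_Comp.IH(1)] list_all2_lengthD[OF ys'(1)] by simp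
    fix i assume i: "i < length ys"
    with len have "converges X (gs ! i) xs (ys' ! i)"
      by (simp add: list_all2_nthD2[OF ys'(1)])
    with list_all2_nthD2[OF converges_Comp.IH(1) i] show "ys ! i = ys' ! i" by blast
  qed
  then show ?case using converges_Comp.IH(2) ys'(2) by blast
next
  case (converges_PrimRec_0 f xs y g)
  from converges_PrimRec_0.prems have "converges X f xs z" by (rule converges_PrimRec_0E)
  then show ?case by (rule converges_PrimRec_0.IH)
next
  case (converges_PrimRec_Suc f g n xs r y)
  from converges_PrimRec_Suc.prems obtain r' where
    r': "converges X (PrimRec f g) (n # xs) r'" "converges X g (n # r' # xs) z"
    by (rule converges_PrimRec_SucE)
  have "r = r'" using r'(1) by (rule converges_PrimRec_Suc.IH(1))
  with r'(2) show ?case using converges_PrimRec_Suc.IH(2) by blast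
next
  case (converges_Mu f n xs)
  from converges_Mu.prems have z: "converges X f (z # xs) 0" by (rule converges_MuE)
  from converges_Mu.prems have below_z: "\<forall>m<z. \<exists>y. converges X f (m # xs) (Suc y)"
    by (rule converges_MuE)
  have "\<not> z < n"
  proof
    assume "z < n"
    with converges_Mu.IH(2) obtain y where "\<And>v. converges X f (z # xs) v \<Longrightarrow> Suc y = v" by blast
    from this[OF z] show False by simp
  qed
  moreover have "\<not> n < z"
  proof
    assume "n < z"
    with below_z obtain y where "converges X f (n # xs) (Suc y)" by blast
    from converges_Mu.IH(1)[OF this] show False by simp
  qed
  ultimately show ?case by simp
next
  case (converges_Zero xs)
  then show ?case by (rule converges_ZeroE) simp
next
  case (converges_Succ x)
  then show ?case by (rule converges_SuccE) simp
next
  case (converges_Proj i xs)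
  from converges_Proj.prems show ?case by (rule converges_ProjE) simp
next
  case (converges_Oracle x)
  then show ?case by (rule converges_OracleE) simp
qed

definition computable_in :: "nat set \<Rightarrow> (nat \<Rightarrow> nat) \<Rightarrow> bool" where
  "computable_in X f \<longleftrightarrow> (\<exists>p. \<forall>n. converges X p [n] (f n))"

text \<open>The empty oracle only answers \<open>0\<close>, so it is the same as having no oracle.\<close>

definition computable :: "(nat \<Rightarrow> nat) \<Rightarrow> bool" where
  "computable f \<longleftrightarrow> computable_in {} f"

definition computably_enumerable :: "nat set \<Rightarrow> bool" where
  "computably_enumerable A \<longleftrightarrow> A = {} \<or> (\<exists>f. computable f \<and> A = range f)"

definition turing_reducible :: "nat set \<Rightarrow> nat set \<Rightarrow> bool" where
  "turing_reducible X Y \<longleftrightarrow> computable_in Y (\<lambda>n. of_bool (n \<in> X))"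

definition turing_equivalent :: "nat set \<Rightarrow> nat set \<Rightarrow> bool" where
  "turing_equivalent X Y \<longleftrightarrow> turing_reducible X Y \<and> turing_reducible Y X"

definition of_ce_degree :: "nat set \<Rightarrow> bool" where
  "of_ce_degree X \<longleftrightarrow> (\<exists>W. computably_enumerable W \<and> turing_equivalent X W)"

definition eq_star :: "nat set \<Rightarrow> nat set \<Rightarrow> bool" (infix "=\<^sup>*" 50) where
  "X =\<^sup>* Y \<longleftrightarrow> finite (sym_diff X Y)"

definition super_maximal_pair :: "nat set \<Rightarrow> nat set \<Rightarrow> bool" where
  "super_maximal_pair A B \<longleftrightarrow>
     computably_enumerable A \<and> computably_enumerable B \<and>
     A \<inter> B = {} \<and>
     infinite (- (A \<union> B)) \<and>
     (\<forall>X. of_ce_degree X \<longrightarrow> A \<subseteq> X \<longrightarrow> B \<subseteq> - X \<longrightarrow> X =\<^sup>* A \<or> - X =\<^sup>* B)"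

end

theory Submission
  imports Defs "HOL-Library.Nat_Bijection" "HOL-Library.Infinite_Set"
begin

text \<open>
  Let \<open>R\<close> be the complement of \<open>A \<union> B\<close>. Suppose a separator \<open>X\<close> is approximated by flags, and flags
  change only when some smaller element permanently receives, by entering \<open>A\<close> or \<open>B\<close>, the value opposite
  to its flag (a hit). Then \<open>X\<close> has c.e. degree, because the segments left by the approximation form a
  c.e. set Turing equivalent to \<open>X\<close>. So it suffices to find such an \<open>X\<close> that splits \<open>R\<close> into two
  infinite parts.

  The numbers are divided into consecutive intervals, the phases, and phase \<open>j\<close> wants a number outside
  \<open>A \<union> B\<close> with flag \<open>j mod 2\<close>; while it has none, it absorbs everything beyond it. A hit at \<open>q\<close> in phase
  \<open>j\<close> gives the flag \<open>j mod 2\<close> to everything above \<open>q\<close>. If all phases succeed, then \<open>X\<close> splits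
  \<open>R\<close>. Otherwise the first phase \<open>i\<close> that keeps growing yields faster enumerations in which an
  element that later enters \<open>B\<close> (\<open>i\<close> even) or \<open>A\<close> (\<open>i\<close> odd) dooms everything present above it to leave
  \<open>R\<close> as well. By symmetry let it be \<open>B\<close>. Running the construction again on these enumerations, an even
  phase can no longer fail, so now elements entering \<open>A\<close> are doomed in the same way, too. But then,
  for \<open>r \<in> R\<close> seen at stage \<open>r\<close>, the elements present below \<open>r\<close> are exactly those of \<open>R\<close>, so their parity
  gives a computable set that splits \<open>R\<close>.
\<close>

subsection \<open>Closure properties of relative computability\<close>


lemma converges_Comp1:
  "converges X g xs a \<Longrightarrow> converges X f [a] z \<Longrightarrow> converges X (Comp f [g]) xs z"
  by (rule converges_Comp[where ys = "[a]"]) auto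

lemma converges_Comp2:
  "converges X g xs a \<Longrightarrow> converges X h xs b \<Longrightarrow> converges X f [a, b] z
    \<Longrightarrow> converges X (Comp f [g, h]) xs z"
  by (rule converges_Comp[where ys = "[a, b]"]) auto

lemma converges_Proj_eq: "i < length xs \<Longrightarrow> xs ! i = y \<Longrightarrow> converges X (Proj i) xs y"
  using converges_Proj by blast

lemma converges_PrimRec:
  assumes "converges X f xs b" "\<And>n r. converges X g (n # r # xs) (h n r)"
  shows "converges X (PrimRec f g) (n # xs) (rec_nat b h n)"
  by (induction n) (auto intro: converges.intros assms)

text \<open>Coding two arguments by a pair has to wait until the projections are known to be
  computable; \<open>computable2_in_iff\<close> then reduces binary functions to unary ones.\<close>

definition computable2_in :: "nat set \<Rightarrow> (nat \<Rightarrow> nat \<Rightarrow> nat) \<Rightarrow> bool" where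
  "computable2_in X F \<longleftrightarrow> (\<exists>p. \<forall>a b. converges X p [a, b] (F a b))"

lemma computable_in_id: "computable_in X (\<lambda>n. n)"
  unfolding computable_in_def by (rule exI[of _ "Proj 0"]) (auto intro: converges_Proj_eq)

lemma computable_in_comp:
  assumes "computable_in X f" "computable_in X g"
  shows "computable_in X (\<lambda>n. f (g n))"
  using assms unfolding computable_in_def by (meson converges_Comp1)

lemma computable_in_Suc: "computable_in X f \<Longrightarrow> computable_in X (\<lambda>n. Suc (f n))"
  unfolding computable_in_def by (meson converges_Comp1 converges_Succ)

lemma computable_in_const: "computable_in X (\<lambda>n. c)"
proof (induction c)
  case 0
  show ?case
    unfolding computable_in_def by (rule exI[of _ Zero]) (auto intro: converges.intros)
qed (rule computable_in_Suc)

lemma computable2_in_app: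
  assumes "computable2_in X F" "computable_in X f" "computable_in X g"
  shows "computable_in X (\<lambda>n. F (f n) (g n))"
  using assms unfolding computable_in_def computable2_in_def by (meson converges_Comp2)

lemma computable_in_rec0:
  assumes "computable2_in X h"
  shows "computable_in X (rec_nat b h)"
proof -
  obtain p where p: "\<And>a b. converges X p [a, b] (h a b)"
    using assms by (auto simp: computable2_in_def)
  obtain q where q: "\<And>n. converges X q [n] b"
    using computable_in_const[of X b] by (auto simp: computable_in_def)
  \<comment> \<open>The second copy of \<open>n\<close> is a dummy parameter, because the base
    program \<open>q\<close> expects one argument.\<close>
  have "converges X (Comp (PrimRec q (Comp p [Proj 0, Proj 1])) [Proj 0, Proj 0]) [n] (rec_nat b h n)" for n
    by (rule converges_Comp2[where a = n and b = n])
       (auto intro!: converges_PrimRec q converges_Comp2[OF _ _ p] converges_Proj_eq)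
  then show ?thesis by (auto simp: computable_in_def)
qed

lemma computable2_in_fst: "computable2_in X (\<lambda>a b. a)"
  unfolding computable2_in_def by (rule exI[of _ "Proj 0"]) (auto intro: converges_Proj_eq)

lemma computable2_in_snd: "computable2_in X (\<lambda>a b. b)"
  unfolding computable2_in_def by (rule exI[of _ "Proj 1"]) (auto intro: converges_Proj_eq)

lemma computable2_in_comp:
  assumes "computable2_in X F" "computable2_in X f" "computable2_in X g"
  shows "computable2_in X (\<lambda>a b. F (f a b) (g a b))"
proof -
  obtain p q r where "\<And>a b. converges X p [a, b] (F a b)" "\<And>a b. converges X q [a, b] (f a b)"
    "\<And>a b. converges X r [a, b] (g a b)"
    using assms by (auto simp: computable2_in_def)
  then have "\<forall>a b. converges X (Comp p [q, r]) [a, b] (F (f a b) (g a b))"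
    by (meson converges_Comp2)
  then show ?thesis unfolding computable2_in_def by blast
qed

lemma computable2_in_comp1:
  assumes "computable_in X F" "computable2_in X f"
  shows "computable2_in X (\<lambda>a b. F (f a b))"
proof -
  obtain p q where "\<And>a. converges X p [a] (F a)" "\<And>a b. converges X q [a, b] (f a b)"
    using assms by (auto simp: computable2_in_def computable_in_def)
  then have "\<forall>a b. converges X (Comp p [q]) [a, b] (F (f a b))"
    by (meson converges_Comp1)
  then show ?thesis unfolding computable2_in_def by blast
qed

lemma computable2_in_iterate:
  assumes "computable_in X b" "computable2_in X h"
  shows "computable2_in X (\<lambda>n e. rec_nat (b e) (\<lambda>_ r. h r e) n)"
proof -
  obtain p q where p: "\<And>a b. converges X p [a, b] (h a b)" and q: "\<And>e. converges X q [e] (b e)"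
    using assms by (auto simp: computable2_in_def computable_in_def)
  have "converges X (PrimRec q (Comp p [Proj 1, Proj 2])) [n, e] (rec_nat (b e) (\<lambda>_ r. h r e) n)"
    for n e
    by (auto intro!: converges_PrimRec q converges_Comp2[OF _ _ p] converges_Proj_eq)
  then show ?thesis by (auto simp: computable2_in_def)
qed

lemma computable2_in_add: "computable2_in X (+)"
proof -
  have "rec_nat b (\<lambda>_ r. Suc r) a = a + b" for a b
    by (induction a) auto
  then show ?thesis
    using computable2_in_iterate[OF computable_in_id
      computable2_in_comp1[OF computable_in_Suc[OF computable_in_id] computable2_in_fst]]
    by simp
qed

lemma computable2_in_mult: "computable2_in X (*)"
proof -
  have "rec_nat 0 (\<lambda>_ r. r + b) a = a * b" for a b :: nat
    by (induction a) auto
  then show ?thesis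
    using computable2_in_iterate[OF computable_in_const[of X 0] computable2_in_add] by simp
qed

lemma computable_in_pred0: "computable_in X (\<lambda>n. n - 1)"
proof -
  have "rec_nat 0 (\<lambda>n r. n) = (\<lambda>n. n - 1)"
  proof
    show "rec_nat 0 (\<lambda>n r. n) n = n - 1" for n by (cases n) auto
  qed
  then show ?thesis using computable_in_rec0[OF computable2_in_fst, of X 0] by simp
qed

lemma computable2_in_diff: "computable2_in X (-)"
proof -
  have "rec_nat b (\<lambda>_ r. r - 1) a = b - a" for a b :: nat
    by (induction a) auto
  then have "computable2_in X (\<lambda>a b. b - a)"
    using computable2_in_iterate[OF computable_in_id
      computable2_in_comp1[OF computable_in_pred0 computable2_in_fst], of X]
    by simp
  from computable2_in_comp[OF this computable2_in_snd computable2_in_fst]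
  show ?thesis .
qed

lemmas computable_in_add = computable2_in_app[OF computable2_in_add]
lemmas computable_in_mult = computable2_in_app[OF computable2_in_mult]
lemmas computable_in_diff = computable2_in_app[OF computable2_in_diff]

section \<open>Cantor pairing, its inverses, and general primitive recursion\<close>

abbreviation pair :: "nat \<Rightarrow> nat \<Rightarrow> nat" where
  "pair a b \<equiv> prod_encode (a, b)"

definition pfst :: "nat \<Rightarrow> nat" where
  "pfst z = fst (prod_decode z)"

definition psnd :: "nat \<Rightarrow> nat" where
  "psnd z = snd (prod_decode z)"

lemma pfst_pair [simp]: "pfst (pair a b) = a"
  and psnd_pair [simp]: "psnd (pair a b) = b"
  and pair_pfst_psnd [simp]: "pair (pfst z) (psnd z) = z"
  by (auto simp: pfst_def psnd_def)

lemma pfst_0 [simp]: "pfst 0 = 0" and psnd_0 [simp]: "psnd 0 = 0"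
proof -
  have "pair 0 0 = 0" by (simp add: prod_encode_def)
  then show "pfst 0 = 0" "psnd 0 = 0" by (metis pfst_pair, metis psnd_pair)
qed

lemma computable_in_triangle0: "computable_in X triangle"
proof -
  have "rec_nat 0 (\<lambda>n r. r + Suc n) = triangle"
  proof
    show "rec_nat 0 (\<lambda>n r. r + Suc n) n = triangle n" for n by (induction n) auto
  qed
  moreover have "computable2_in X (\<lambda>n r. r + Suc n)"
    by (intro computable2_in_comp[OF computable2_in_add] computable2_in_snd
        computable2_in_comp1[OF computable_in_Suc[OF computable_in_id]] computable2_in_fst)
  ultimately show ?thesis using computable_in_rec0[of X "\<lambda>n r. r + Suc n" 0] by simp
qed

lemmas computable_in_triangle = computable_in_comp[OF computable_in_triangle0]

lemma computable_in_pair: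
  "computable_in X f \<Longrightarrow> computable_in X g \<Longrightarrow> computable_in X (\<lambda>n. pair (f n) (g n))"
  unfolding prod_encode_def prod.case
  by (intro computable_in_add computable_in_triangle)

lemma computable_in_Mu2:
  assumes F: "computable2_in X F" and ex: "\<And>e. \<exists>i. F i e = 0"
  shows "computable_in X (\<lambda>e. LEAST i. F i e = 0)"
proof -
  obtain p where p: "\<And>a b. converges X p [a, b] (F a b)"
    using F by (auto simp: computable2_in_def)
  have "converges X (Mu p) [e] (LEAST i. F i e = 0)" for e
  proof (rule converges_Mu)
    show "converges X p [LEAST i. F i e = 0, e] 0"
      using p[of "LEAST i. F i e = 0" e] LeastI_ex[OF ex[of e]] by simp
    show "\<forall>m<LEAST i. F i e = 0. \<exists>y. converges X p [m, e] (Suc y)"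
    proof (intro allI impI)
      fix m assume "m < (LEAST i. F i e = 0)"
      then have "F m e \<noteq> 0" using not_less_Least by blast
      then show "\<exists>y. converges X p [m, e] (Suc y)"
        using p[of m e] by (metis not0_implies_Suc)
    qed
  qed
  then show ?thesis by (auto simp: computable_in_def)
qed

lemma triangle_mono: "a \<le> b \<Longrightarrow> triangle a \<le> triangle b"
  by (induction rule: dec_induct) auto

text \<open>\<open>z\<close> lies on the diagonal \<open>d = pfst z + psnd z\<close>, where
  \<open>triangle d \<le> z < triangle (Suc d)\<close>. The truncated difference vanishes exactly
  when \<open>z < triangle (Suc d)\<close>, so an unbounded search finds the diagonal.\<close>

lemma psum_Least:
  "(LEAST d. Suc z - triangle (Suc d) = 0) = pfst z + psnd z"
proof -
  have z: "z = triangle (pfst z + psnd z) + pfst z"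
    using pair_pfst_psnd[of z] by (simp add: prod_encode_def)
  show ?thesis
  proof (rule Least_equality)
    show "Suc z - triangle (Suc (pfst z + psnd z)) = 0"
      using z by simp
    fix d assume d: "Suc z - triangle (Suc d) = 0"
    show "pfst z + psnd z \<le> d"
    proof (rule ccontr)
      assume "\<not> pfst z + psnd z \<le> d"
      then have "triangle (Suc d) \<le> triangle (pfst z + psnd z)"
        by (intro triangle_mono) simp
      with d z show False by linarith
    qed
  qed
qed

lemma computable_in_psum0: "computable_in X (\<lambda>z. pfst z + psnd z)"
proof -
  have "computable2_in X (\<lambda>d z. Suc z - triangle (Suc d))"
    by (intro computable2_in_comp[OF computable2_in_diff] computable2_in_fst computable2_in_snd
        computable2_in_comp1[OF computable_in_triangle0]
        computable2_in_comp1[OF computable_in_Suc[OF computable_in_id]])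
  moreover have "\<exists>i. Suc e - triangle (Suc i) = 0" for e
    by (rule exI[of _ e]) simp
  ultimately show ?thesis
    using computable_in_Mu2[of X "\<lambda>d z. Suc z - triangle (Suc d)"] by (simp only: psum_Least)
qed

lemma computable_in_pfst0: "computable_in X pfst"
proof -
  have "z - triangle (pfst z + psnd z) = pfst z" for z
    using pair_pfst_psnd[of z] by (simp add: prod_encode_def)
  moreover have "computable_in X (\<lambda>z. z - triangle (pfst z + psnd z))"
    by (intro computable_in_diff computable_in_triangle computable_in_id computable_in_psum0)
  ultimately show ?thesis by simp
qed

lemmas computable_in_pfst = computable_in_comp[OF computable_in_pfst0]

lemma computable_in_psnd0: "computable_in X psnd"
proof -
  have "(pfst z + psnd z) - pfst z = psnd z" for z
    by simp
  moreover have "computable_in X (\<lambda>z. (pfst z + psnd z) - pfst z)"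
    by (intro computable_in_diff computable_in_pfst0 computable_in_psum0)
  ultimately show ?thesis by simp
qed

lemmas computable_in_psnd = computable_in_comp[OF computable_in_psnd0]

lemma computable2_in_iff:
  "computable2_in X F \<longleftrightarrow> computable_in X (\<lambda>z. F (pfst z) (psnd z))"
proof
  assume "computable2_in X F"
  then show "computable_in X (\<lambda>z. F (pfst z) (psnd z))"
    by (rule computable2_in_app) (rule computable_in_pfst0 computable_in_psnd0)+
next
  assume *: "computable_in X (\<lambda>z. F (pfst z) (psnd z))"
  have "computable2_in X pair"
    unfolding prod_encode_def prod.case
    by (intro computable2_in_comp[OF computable2_in_add] computable2_in_comp1[OF computable_in_triangle0]
        computable2_in_fst computable2_in_snd)
  from computable2_in_comp1[OF * this] show "computable2_in X F" by simp
qed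

lemma computable_in_rec:
  assumes b: "computable_in X b" and k: "computable_in X k"
    and h: "computable_in X (\<lambda>z. h (pfst z) (pfst (psnd z)) (psnd (psnd z)))"
  shows "computable_in X (\<lambda>e. rec_nat (b e) (h e) (k e))"
proof -
  \<comment> \<open>\<open>computable2_in_iterate\<close> does not show the counter to the step
    function, so the counter is carried in the first component.\<close>
  define g where "g r e = pair (Suc (pfst r)) (h e (pfst r) (psnd r))" for r e
  have g: "computable2_in X g"
    unfolding computable2_in_iff g_def
    using computable_in_comp[OF h computable_in_pair[OF computable_in_psnd0
        computable_in_pair[OF computable_in_pfst[OF computable_in_pfst0]
          computable_in_psnd[OF computable_in_pfst0]]]]
    by (intro computable_in_pair computable_in_Suc computable_in_pfst computable_in_id) simp
  have "rec_nat (pair 0 (b e)) (\<lambda>_ r. g r e) n = pair n (rec_nat (b e) (h e) n)" for n e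
    by (induction n) (auto simp: g_def)
  then have "computable2_in X (\<lambda>n e. pair n (rec_nat (b e) (h e) n))"
    using computable2_in_iterate[OF computable_in_pair[OF computable_in_const b] g, of 0] by simp
  from computable_in_psnd[OF computable2_in_app[OF this k computable_in_id]]
  show ?thesis by simp
qed

lemma computable_in_sum:
  assumes k: "computable_in X k" and f: "computable_in X (\<lambda>z. f (pfst z) (psnd z))"
  shows "computable_in X (\<lambda>e. \<Sum>i<k e. f e i)"
proof -
  have "rec_nat 0 (\<lambda>i r. r + f e i) n = (\<Sum>i<n. f e i)" for e n
    by (induction n) auto
  moreover have "computable_in X (\<lambda>e. rec_nat 0 (\<lambda>i r. r + f e i) (k e))"
  proof (rule computable_in_rec[OF computable_in_const k])
    show "computable_in X (\<lambda>z. psnd (psnd z) + f (pfst z) (pfst (psnd z)))"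
      using computable_in_comp[OF f computable_in_pair[OF computable_in_pfst0
          computable_in_pfst[OF computable_in_psnd0]]]
      by (intro computable_in_add computable_in_psnd computable_in_id) simp
  qed
  ultimately show ?thesis by simp
qed

section \<open>Decidable predicates, bounded quantifiers and search\<close>

abbreviation decidable_in :: "nat set \<Rightarrow> (nat \<Rightarrow> bool) \<Rightarrow> bool" where
  "decidable_in X P \<equiv> computable_in X (\<lambda>n. of_bool (P n))"

lemma decidable_in_not:
  assumes "decidable_in X P"
  shows "decidable_in X (\<lambda>n. \<not> P n)"
proof -
  have "computable_in X (\<lambda>n. 1 - of_bool (P n))"
    by (intro computable_in_diff computable_in_const assms)
  moreover have "1 - of_bool (P n) = (of_bool (\<not> P n) :: nat)" for n
    by simp
  ultimately show ?thesis by (simp only:)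
qed

lemma decidable_in_conj:
  "decidable_in X P \<Longrightarrow> decidable_in X Q \<Longrightarrow> decidable_in X (\<lambda>n. P n \<and> Q n)"
  unfolding of_bool_conj by (rule computable_in_mult)

lemma disj_conv_conj_not: "P \<or> Q \<longleftrightarrow> \<not> (\<not> P \<and> \<not> Q)"
  by blast

lemma decidable_in_disj:
  "decidable_in X P \<Longrightarrow> decidable_in X Q \<Longrightarrow> decidable_in X (\<lambda>n. P n \<or> Q n)"
  unfolding disj_conv_conj_not by (intro decidable_in_not decidable_in_conj)

lemma decidable_in_imp:
  "decidable_in X P \<Longrightarrow> decidable_in X Q \<Longrightarrow> decidable_in X (\<lambda>n. P n \<longrightarrow> Q n)"
  unfolding imp_conv_disj by (intro decidable_in_not decidable_in_disj)

lemma decidable_in_le: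
  assumes "computable_in X f" "computable_in X g"
  shows "decidable_in X (\<lambda>n. f n \<le> g n)"
proof -
  have "computable_in X (\<lambda>n. 1 - (f n - g n))"
    by (intro computable_in_diff computable_in_const assms)
  moreover have "1 - (a - b) = (of_bool (a \<le> b) :: nat)" for a b :: nat by auto
  ultimately show ?thesis by simp
qed

lemma decidable_in_less:
  assumes "computable_in X f" "computable_in X g"
  shows "decidable_in X (\<lambda>n. f n < g n)"
  unfolding Suc_le_eq[symmetric] by (intro decidable_in_le computable_in_Suc assms)

lemma decidable_in_eq:
  assumes "computable_in X f" "computable_in X g"
  shows "decidable_in X (\<lambda>n. f n = g n)"
  unfolding eq_iff[where 'a = nat] by (intro decidable_in_conj decidable_in_le assms)

lemma computable_in_if:
  assumes "decidable_in X P" "computable_in X f" "computable_in X g"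
  shows "computable_in X (\<lambda>n. if P n then f n else g n)"
proof -
  have "computable_in X (\<lambda>n. of_bool (P n) * f n + of_bool (\<not> P n) * g n)"
    by (intro computable_in_add computable_in_mult decidable_in_not assms)
  moreover have "of_bool (P n) * f n + of_bool (\<not> P n) * g n = (if P n then f n else g n)" for n
    by simp
  ultimately show ?thesis by simp
qed

lemma decidable_in_ex:
  assumes "computable_in X k" "decidable_in X (\<lambda>z. P (pfst z) (psnd z))"
  shows "decidable_in X (\<lambda>e. \<exists>i<k e. P e i)"
proof -
  have "decidable_in X (\<lambda>e. 0 < (\<Sum>i<k e. (of_bool (P e i) :: nat)))"
    by (intro decidable_in_less computable_in_const computable_in_sum assms)
  moreover have "0 < (\<Sum>i<n. (of_bool (P e i) :: nat)) \<longleftrightarrow> (\<exists>i<n. P e i)" for n e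
    by (auto simp: sum_eq_0_iff simp flip: neq0_conv)
  ultimately show ?thesis by simp
qed

lemma decidable_in_all:
  assumes "computable_in X k" "decidable_in X (\<lambda>z. P (pfst z) (psnd z))"
  shows "decidable_in X (\<lambda>e. \<forall>i<k e. P e i)"
proof -
  have "decidable_in X (\<lambda>e. \<not> (\<exists>i<k e. \<not> P e i))"
    by (intro decidable_in_not decidable_in_ex assms)
  then show ?thesis by (simp only: not_ex de_Morgan_conj not_not imp_conv_disj)
qed

lemma computable_in_Least:
  assumes P: "decidable_in X (\<lambda>z. P (pfst z) (psnd z))" and ex: "\<And>e. \<exists>i. P e i"
  shows "computable_in X (\<lambda>e. LEAST i. P e i)"
proof -
  have "computable2_in X (\<lambda>i e. of_bool (\<not> P e i))"
    unfolding computable2_in_iff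
    using computable_in_comp[OF decidable_in_not[OF P] computable_in_pair[OF computable_in_psnd0 computable_in_pfst0]]
    by simp
  from computable_in_Mu2[OF this] ex show ?thesis by simp
qed

lemma computable_in_mod2: 
  assumes "computable_in X f"
  shows "computable_in X (\<lambda>n. f n mod 2)"
proof -
  have "rec_nat 0 (\<lambda>_ r. 1 - r) n = n mod 2" for n :: nat
    by (induction n) (auto simp: mod_Suc)
  moreover have "computable_in X (\<lambda>n. rec_nat 0 (\<lambda>_ r. 1 - r) (f n))"
    by (intro computable_in_rec computable_in_const assms computable_in_diff computable_in_psnd
        computable_in_id)
  ultimately show ?thesis by simp
qed

lemma computable_in_min:
  "computable_in X f \<Longrightarrow> computable_in X g \<Longrightarrow> computable_in X (\<lambda>n. min (f n) (g n))"
  unfolding min_def by (intro computable_in_if decidable_in_le)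

lemma decidable_in_oracle: "computable_in X f \<Longrightarrow> decidable_in X (\<lambda>n. f n \<in> X)"
  unfolding computable_in_def by (meson converges_Comp1 converges_Oracle)

lemmas computable_intros = computable_in_id computable_in_const computable_in_Suc computable_in_add
  computable_in_mult computable_in_diff computable_in_pair computable_in_pfst computable_in_psnd
  computable_in_sum computable_in_if computable_in_mod2 computable_in_min
  decidable_in_not decidable_in_conj decidable_in_disj decidable_in_imp decidable_in_le
  decidable_in_less decidable_in_eq decidable_in_ex decidable_in_all

section \<open>Removing the oracle, and c.e. sets as projections\<close>

fun drop_oracle :: "recf \<Rightarrow> recf" where
  "drop_oracle Oracle = Zero"
| "drop_oracle (Comp f gs) = Comp (drop_oracle f) (map drop_oracle gs)"
| "drop_oracle (PrimRec f g) = PrimRec (drop_oracle f) (drop_oracle g)"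
| "drop_oracle (Mu f) = Mu (drop_oracle f)"
| "drop_oracle p = p"

text \<open>The empty oracle answers every query with 0, just as \<open>Zero\<close> does, and
  without queries the actual oracle is irrelevant.\<close>

lemma converges_drop_oracle: "converges {} p xs y \<Longrightarrow> converges X (drop_oracle p) xs y"
proof (induction rule: converges.induct)
  case (converges_Comp xs gs ys f z)
  then show ?case
    by (auto intro!: converges.converges_Comp[where ys = ys] simp: list_all2_conv_all_nth)
next
  case (converges_Mu f n xs)
  then show ?case by (auto intro!: converges.converges_Mu)
qed (auto intro: converges.intros)

lemma computable_imp_computable_in: "computable f \<Longrightarrow> computable_in X f"
  unfolding computable_def computable_in_def using converges_drop_oracle by blast

lemma computably_enumerable_ex:
  assumes P: "decidable_in {} (\<lambda>z. P (pfst z) (psnd z))"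
  shows "computably_enumerable {n. \<exists>t. P n t}"
proof (cases "{n. \<exists>t. P n t} = {}")
  case True
  then show ?thesis by (simp add: computably_enumerable_def)
next
  case False
  then obtain n t where nt: "P n t" by blast
  \<comment> \<open>The member \<open>n\<close> of the set is the default value at pairs that are
    not witnesses.\<close>
  define f where "f z = (if P (pfst z) (psnd z) then pfst z else n)" for z
  have "computable_in {} f"
    unfolding f_def by (intro computable_intros P)
  moreover have "{n. \<exists>t. P n t} = range f"
  proof
    show "{n. \<exists>t. P n t} \<subseteq> range f"
    proof
      fix m assume "m \<in> {n. \<exists>t. P n t}"
      then obtain u where "P m u" by blast
      then have "f (pair m u) = m" by (simp add: f_def)
      then show "m \<in> range f" by (metis rangeI)
    qed
    show "range f \<subseteq> {n. \<exists>t. P n t}" using nt by (auto simp: f_def)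
  qed
  ultimately show ?thesis by (auto simp: computably_enumerable_def computable_def)
qed


lemma computable_in_app2:
  assumes "computable_in X (\<lambda>z. F (pfst z) (psnd z))" "computable_in X f" "computable_in X g"
  shows "computable_in X (\<lambda>n. F (f n) (g n))"
  using computable2_in_app[of X F] assms by (simp add: computable2_in_iff)

lemma computable_in_app3:
  assumes "computable_in X (\<lambda>z. F (pfst z) (pfst (psnd z)) (psnd (psnd z)))"
    "computable_in X f" "computable_in X g" "computable_in X h"
  shows "computable_in X (\<lambda>n. F (f n) (g n) (h n))"
  using computable_in_comp[OF assms(1) computable_in_pair[OF assms(2) computable_in_pair[OF assms(3,4)]]]
  by simp

subsection \<open>Sets of c.e. degree as limits\<close>

text \<open>Every revision of an initial segment involves a final change inside it, so a segment
  once left is wrong forever. This is what makes the set of wrong segments c.e.\<close>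

locale permanent_changes =
  fixes Y :: "nat \<Rightarrow> nat set"
  assumes change: "(p \<in> Y m) \<noteq> (p \<in> Y (Suc m)) \<Longrightarrow>
    \<exists>q\<le>p. (q \<in> Y m) \<noteq> (q \<in> Y (Suc m)) \<and> (\<forall>t>m. q \<in> Y t \<longleftrightarrow> q \<in> Y (Suc m))"
begin

definition limit :: "nat set" where
  "limit = {p. \<exists>s. \<forall>t\<ge>s. p \<in> Y t}"

text \<open>Strong induction: once all numbers below \<open>p\<close> have settled, the final change
  that accompanies a change at \<open>p\<close> can only be the one at \<open>p\<close>
  itself.\<close>

lemma eventually_const: "\<exists>s. \<forall>t\<ge>s. p \<in> Y t \<longleftrightarrow> p \<in> Y s"
proof (induction p rule: less_induct)
  case (less p)
  then have "\<forall>q. \<exists>s. q < p \<longrightarrow> (\<forall>t\<ge>s. q \<in> Y t \<longleftrightarrow> q \<in> Y s)" by blast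
  then obtain \<sigma> where \<sigma>: "\<And>q t. q < p \<Longrightarrow> t \<ge> \<sigma> q \<Longrightarrow> q \<in> Y t \<longleftrightarrow> q \<in> Y (\<sigma> q)"
    by metis
  define s where "s = Max (insert 0 (\<sigma> ` {..<p}))"
  have s: "\<sigma> q \<le> s" if "q < p" for q
    using that by (auto simp: s_def)
  show ?case
  proof (cases "\<exists>m\<ge>s. (p \<in> Y m) \<noteq> (p \<in> Y (Suc m))")
    case False
    have "p \<in> Y t \<longleftrightarrow> p \<in> Y s" if "t \<ge> s" for t
      using that by (induction rule: dec_induct) (use False in blast)+
    then show ?thesis by blast
  next
    case True
    then obtain m where m: "m \<ge> s" "(p \<in> Y m) \<noteq> (p \<in> Y (Suc m))" by blast
    from change[OF m(2)] obtain q where q: "q \<le> p" "(q \<in> Y m) \<noteq> (q \<in> Y (Suc m))"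
      "\<forall>t>m. q \<in> Y t \<longleftrightarrow> q \<in> Y (Suc m)" by blast
    have "\<not> q < p"
    proof
      assume "q < p"
      with \<sigma>[of q m] \<sigma>[of q "Suc m"] s[of q] m(1) q(2) show False
        by (meson le_SucI order_trans)
    qed
    with q(1) have "q = p" by simp
    with q(3) show ?thesis by (meson Suc_le_eq)
  qed
qed

lemma eventually_limit: "\<exists>s. \<forall>t\<ge>s. p \<in> Y t \<longleftrightarrow> p \<in> limit"
proof -
  obtain s where s: "\<And>t. t \<ge> s \<Longrightarrow> p \<in> Y t \<longleftrightarrow> p \<in> Y s"
    using eventually_const[of p] by blast
  have "p \<in> limit \<longleftrightarrow> p \<in> Y s"
  proof
    assume "p \<in> limit"
    then obtain u where "\<forall>t\<ge>u. p \<in> Y t" by (auto simp: limit_def)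
    then have "p \<in> Y (max s u)" by simp
    with s[of "max s u"] show "p \<in> Y s" by (simp only: max.cobounded1)
  next
    assume "p \<in> Y s"
    then show "p \<in> limit" using s unfolding limit_def by blast
  qed
  with s show ?thesis by blast
qed

lemma eventually_limit_below: "\<exists>s. \<forall>t\<ge>s. \<forall>p<n. p \<in> Y t \<longleftrightarrow> p \<in> limit"
proof (induction n)
  case (Suc n)
  then obtain s where s: "\<forall>t\<ge>s. \<forall>p<n. p \<in> Y t \<longleftrightarrow> p \<in> limit" by blast
  obtain u where u: "\<forall>t\<ge>u. n \<in> Y t \<longleftrightarrow> n \<in> limit" using eventually_limit by blast
  show ?case
  proof (intro exI allI impI)
    fix t p assume t: "max s u \<le> t" and p: "p < Suc n"
    show "p \<in> Y t \<longleftrightarrow> p \<in> limit"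
    proof (cases "p = n")
      case True
      then show ?thesis using u t max.boundedE by blast
    next
      case False
      then have "p < n" using p by linarith
      then show ?thesis using s t max.boundedE by blast
    qed
  qed
qed simp

text \<open>A true initial segment is never left, since leaving it would be a permanent change.\<close>

lemma true_segment_stable:
  assumes "\<forall>p<n. p \<in> Y s \<longleftrightarrow> p \<in> limit" "t \<ge> s"
  shows "\<forall>p<n. p \<in> Y t \<longleftrightarrow> p \<in> limit"
  using assms(2)
proof (induction rule: dec_induct)
  case base
  show ?case by (rule assms(1))
next
  case (step m)
  show ?case
  proof (rule ccontr)
    assume "\<not> ?thesis"
    then obtain p where p: "p < n" "(p \<in> Y m) \<noteq> (p \<in> Y (Suc m))" using step.IH by auto
    from change[OF p(2)] p(1) obtain q where q: "q < n" "(q \<in> Y m) \<noteq> (q \<in> Y (Suc m))"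
      "\<forall>t>m. q \<in> Y t \<longleftrightarrow> q \<in> Y (Suc m)" using le_less_trans by blast
    obtain u where "\<forall>t\<ge>u. q \<in> Y t \<longleftrightarrow> q \<in> limit" using eventually_limit[of q] by blast
    then have "q \<in> Y (max u (Suc m)) \<longleftrightarrow> q \<in> limit" by (meson max.cobounded1)
    moreover have "q \<in> Y (max u (Suc m)) \<longleftrightarrow> q \<in> Y (Suc m)"
      using q(3) by (meson Suc_le_lessD max.cobounded2)
    moreover have "q \<in> Y m \<longleftrightarrow> q \<in> limit" using step.IH q(1) by blast
    ultimately show False using q(2) by blast
  qed
qed

text \<open>\<open>W\<close> consists of the pairs (length, stage) whose segment is wrong. A segment
  is wrong iff it differs from that of some later stage, so \<open>W\<close> is c.e. The limit
  decides \<open>W\<close> by comparison, and \<open>W\<close> lets one search for a correct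
  segment, from which the limit is read off.\<close>

lemma of_ce_degree_limit:
  assumes dec: "decidable_in {} (\<lambda>z. psnd z \<in> Y (pfst z))"
  shows "of_ce_degree limit"
proof -
  define W where "W = {z. \<exists>p<pfst z. (p \<in> Y (psnd z)) \<noteq> (p \<in> limit)}"
  have decX: "decidable_in X (\<lambda>z. psnd z \<in> Y (pfst z))" for X
    using computable_imp_computable_in[of _ X] dec by (simp add: computable_def)
  note Yi = computable_in_app2[of _ "\<lambda>a b. of_bool (b \<in> Y a)", OF decX]
  have W_eq: "W = {z. \<exists>t. \<exists>p<pfst z. \<not> ((p \<in> Y (psnd z) \<longrightarrow> p \<in> Y (psnd z + t)) \<and> (p \<in> Y (psnd z + t) \<longrightarrow> p \<in> Y (psnd z)))}"
    (is "_ = ?V")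
  proof
    show "W \<subseteq> ?V"
    proof
      fix z assume "z \<in> W"
      then obtain p where p: "p < pfst z" "(p \<in> Y (psnd z)) \<noteq> (p \<in> limit)" by (auto simp: W_def)
      obtain u where "\<forall>t\<ge>u. p \<in> Y t \<longleftrightarrow> p \<in> limit" using eventually_limit by blast
      then have "p \<in> Y (psnd z + u) \<longleftrightarrow> p \<in> limit" by simp
      with p show "z \<in> ?V" by blast
    qed
    show "?V \<subseteq> W"
    proof (rule subsetI, rule ccontr)
      fix z assume "z \<in> ?V" and "z \<notin> W"
      from \<open>z \<notin> W\<close> have W: "\<forall>p<pfst z. p \<in> Y (psnd z) \<longleftrightarrow> p \<in> limit"
        unfolding W_def by blast
      obtain t p where "p < pfst z" "(p \<in> Y (psnd z)) \<noteq> (p \<in> Y (psnd z + t))"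
        using \<open>z \<in> ?V\<close> by blast
      with W true_segment_stable[OF W, of "psnd z + t"] show False by auto
    qed
  qed
  have "computably_enumerable W"
    unfolding W_eq by (rule computably_enumerable_ex) (intro computable_intros Yi)
  moreover have "turing_reducible W limit"
  proof -
    have "decidable_in limit (\<lambda>z. \<exists>p<pfst z. \<not> ((p \<in> Y (psnd z) \<longrightarrow> p \<in> limit) \<and> (p \<in> limit \<longrightarrow> p \<in> Y (psnd z))))"
      by (intro computable_intros Yi decidable_in_oracle)
    moreover have "(\<lambda>z. z \<in> W) = (\<lambda>z. \<exists>p<pfst z. \<not> ((p \<in> Y (psnd z) \<longrightarrow> p \<in> limit) \<and> (p \<in> limit \<longrightarrow> p \<in> Y (psnd z))))"
      by (auto simp: W_def fun_eq_iff)
    ultimately show ?thesis unfolding turing_reducible_def by metis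
  qed
  moreover have "turing_reducible limit W"
  proof -
    define s where "s n = (LEAST s. pair (Suc n) s \<notin> W)" for n
    have ex: "\<exists>s. pair (Suc n) s \<notin> W" for n
      using eventually_limit_below[of "Suc n"] by (auto simp: W_def)
    have "computable_in W s"
      unfolding s_def
      by (rule computable_in_Least) (intro computable_intros decidable_in_oracle ex)+
    then have "decidable_in W (\<lambda>n. n \<in> Y (s n))"
      by (intro Yi computable_intros)
    moreover have "n \<in> Y (s n) \<longleftrightarrow> n \<in> limit" for n
      using LeastI_ex[OF ex[of n]] by (auto simp: W_def s_def)
    ultimately show ?thesis unfolding turing_reducible_def by simp
  qed
  ultimately show ?thesis unfolding of_ce_degree_def turing_equivalent_def by blast
qed

end

subsection \<open>Tables\<close>

text \<open>Numbers code lists: 0 is the empty list and \<open>Suc (pair a c)\<close> has head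
  \<open>a\<close> and tail \<open>c\<close>. Reading past the end yields 0, since both projections
  of 0 are 0.\<close>

definition look :: "nat \<Rightarrow> nat \<Rightarrow> nat" where
  "look c i = pfst (((\<lambda>r. psnd (r - 1)) ^^ i) c - 1)"

definition table :: "(nat \<Rightarrow> nat) \<Rightarrow> nat \<Rightarrow> nat" where
  "table g m = rec_nat 0 (\<lambda>k r. Suc (pair (g (m - Suc k)) r)) m"

lemma look_0 [simp]: "look 0 i = 0"
proof -
  have "((\<lambda>r. psnd (r - 1)) ^^ i) 0 = 0" by (induction i) auto
  then show ?thesis by (simp add: look_def)
qed

lemma look_Suc_pair: "look (Suc (pair a c)) i = (case i of 0 \<Rightarrow> a | Suc i \<Rightarrow> look c i)"
  by (cases i) (auto simp: look_def funpow_swap1 simp del: funpow.simps(2) simp add: funpow_Suc_right)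

lemma look_table [simp]: "look (table g m) i = (if i < m then g i else 0)"
proof -
  \<comment> \<open>The list is built from its last entry, so after \<open>k\<close> steps it holds
    the values of \<open>g\<close> from \<open>m - k\<close> on.\<close>
  have "look (rec_nat 0 (\<lambda>k r. Suc (pair (g (m - Suc k)) r)) k) i = (if i < k then g (m - k + i) else 0)"
    if "k \<le> m" for k i
    using that
  proof (induction k arbitrary: i)
    case (Suc k)
    then show ?case by (auto simp: look_Suc_pair split: nat.split)
  qed simp
  from this[of m i] show ?thesis by (simp add: table_def)
qed

lemma computable_in_look:
  assumes "computable_in X c" "computable_in X i"
  shows "computable_in X (\<lambda>e. look (c e) (i e))"
proof -
  have "rec_nat c (\<lambda>_ r. psnd (r - 1)) i = ((\<lambda>r. psnd (r - 1)) ^^ i) c" for c i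
    by (induction i) auto
  moreover have "computable_in X (\<lambda>e. pfst (rec_nat (c e) (\<lambda>_ r. psnd (r - 1)) (i e) - 1))"
    by (intro computable_intros computable_in_rec assms)
  ultimately show ?thesis by (simp add: look_def)
qed

lemma computable_in_table:
  assumes m: "computable_in X m" and g: "computable_in X (\<lambda>z. g (pfst z) (psnd z))"
  shows "computable_in X (\<lambda>e. table (g e) (m e))"
  unfolding table_def
  by (intro computable_in_rec computable_intros computable_in_app2[OF g]
      computable_in_comp[OF m] m)

subsection \<open>Pairs of enumerated sets\<close>


text \<open>Both \<open>X\<close> and \<open>- X\<close> are required to have c.e. degree, to make the roles of \<open>A\<close> and \<open>B\<close>
  exchangeable.\<close>

definition splittable :: "nat set \<Rightarrow> nat set \<Rightarrow> bool" where
  "splittable A B \<longleftrightarrow> (\<exists>X. of_ce_degree X \<and> of_ce_degree (- X) \<and> A \<subseteq> X \<and> B \<subseteq> - X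
     \<and> infinite (X - A) \<and> infinite (- X - B))"

lemma splittable_sym: "splittable A B \<Longrightarrow> splittable B A"
  unfolding splittable_def by (metis double_complement)

definition enumeration :: "nat set \<Rightarrow> (nat \<Rightarrow> nat set) \<Rightarrow> bool" where
  "enumeration A \<alpha> \<longleftrightarrow> mono \<alpha> \<and> A = (\<Union>m. \<alpha> m) \<and> decidable_in {} (\<lambda>z. psnd z \<in> \<alpha> (pfst z))"

lemma computably_enumerable_imp_enumeration:
  assumes "computably_enumerable A"
  shows "\<exists>\<alpha>. enumeration A \<alpha>"
proof (cases "A = {}")
  case True
  then have "enumeration A (\<lambda>m. {})"
    using computable_in_const[of "{}" 0] by (simp add: enumeration_def mono_def)
  then show ?thesis by blast
next
  case False
  then obtain f where f: "computable_in {} f" "A = range f"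
    using assms by (auto simp: computably_enumerable_def computable_def)
  have "decidable_in {} (\<lambda>z. \<exists>i<pfst z. f i = psnd z)"
    by (intro computable_intros computable_in_comp[OF f(1)])
  moreover have "(\<lambda>z. \<exists>i<pfst z. f i = psnd z) = (\<lambda>z. psnd z \<in> f ` {..<pfst z})"
    unfolding image_iff Bex_def lessThan_iff by metis
  ultimately have "decidable_in {} (\<lambda>z. psnd z \<in> f ` {..<pfst z})" by metis
  moreover have "mono (\<lambda>m. f ` {..<m})" "A = (\<Union>m. f ` {..<m})"
    unfolding f(2) by (auto simp: mono_def)
  ultimately have "enumeration A (\<lambda>m. f ` {..<m})"
    unfolding enumeration_def by blast
  then show ?thesis by blast
qed

lemma enumeration_speedup:
  assumes \<alpha>: "enumeration A \<alpha>" and \<sigma>: "computable_in {} \<sigma>" "mono \<sigma>" "\<And>n. n \<le> \<sigma> n"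
  shows "enumeration A (\<lambda>n. \<alpha> (\<sigma> n))"
proof -
  have dec: "decidable_in {} (\<lambda>z. psnd z \<in> \<alpha> (pfst z))" and mono: "mono \<alpha>" and A: "A = (\<Union>m. \<alpha> m)"
    using \<alpha> by (auto simp: enumeration_def)
  have "decidable_in {} (\<lambda>z. psnd z \<in> \<alpha> (\<sigma> (pfst z)))"
    by (intro computable_in_app2[of "{}" "\<lambda>a b. of_bool (b \<in> \<alpha> a)", OF dec] computable_intros
        computable_in_comp[OF \<sigma>(1)])
  moreover have "mono (\<lambda>n. \<alpha> (\<sigma> n))"
    using mono \<sigma>(2) by (simp add: mono_def)
  moreover have "A = (\<Union>n. \<alpha> (\<sigma> n))"
    using A monoD[OF mono \<sigma>(3)] by blast
  ultimately show ?thesis by (simp add: enumeration_def)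
qed

locale enumerated_pair =
  fixes A B :: "nat set" and \<alpha> \<beta> :: "nat \<Rightarrow> nat set"
  assumes enum_A: "enumeration A \<alpha>" and enum_B: "enumeration B \<beta>" and disjoint: "A \<inter> B = {}"
begin

definition kept :: "nat \<Rightarrow> nat \<Rightarrow> bool" where
  "kept m n \<longleftrightarrow> \<not> n \<in> \<alpha> m \<and> \<not> n \<in> \<beta> m"

definition R :: "nat set" where
  "R = - (A \<union> B)"

lemma \<alpha>_mono: "m \<le> m' \<Longrightarrow> n \<in> \<alpha> m \<Longrightarrow> n \<in> \<alpha> m'"
  and \<beta>_mono: "m \<le> m' \<Longrightarrow> n \<in> \<beta> m \<Longrightarrow> n \<in> \<beta> m'"
  using enum_A enum_B by (auto simp: enumeration_def dest: monoD)

lemma \<alpha>_A: "n \<in> \<alpha> m \<Longrightarrow> n \<in> A" and \<beta>_B: "n \<in> \<beta> m \<Longrightarrow> n \<in> B"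
  and A_\<alpha>: "n \<in> A \<Longrightarrow> \<exists>m. n \<in> \<alpha> m" and B_\<beta>: "n \<in> B \<Longrightarrow> \<exists>m. n \<in> \<beta> m"
  using enum_A enum_B by (auto simp: enumeration_def)

lemma \<alpha>_\<beta>: "n \<in> \<alpha> m \<Longrightarrow> n \<in> \<beta> m' \<Longrightarrow> False"
  using disjoint \<alpha>_A \<beta>_B by blast

lemma kept_mono: "kept m' n \<Longrightarrow> m \<le> m' \<Longrightarrow> kept m n"
  unfolding kept_def using \<alpha>_mono \<beta>_mono by blast

lemma R_kept: "n \<in> R \<Longrightarrow> kept m n"
  unfolding kept_def R_def using \<alpha>_A \<beta>_B by blast

lemma not_R: "n \<notin> R \<Longrightarrow> \<exists>m. \<not> kept m n"
  unfolding kept_def R_def using A_\<alpha> B_\<beta> by blast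

lemma enters_A:
  assumes "n \<in> A" "kept m n"
  shows "\<exists>t\<ge>m. kept t n \<and> n \<in> \<alpha> (Suc t)"
proof -
  obtain u where "n \<in> \<alpha> u" using A_\<alpha> assms(1) by blast
  moreover have "\<not> n \<in> \<alpha> m" using assms(2) by (simp add: kept_def)
  ultimately obtain t where "t \<ge> m" "\<not> n \<in> \<alpha> t" "n \<in> \<alpha> (Suc t)"
    using dec_induct[of m "max m u" "\<lambda>k. \<not> n \<in> \<alpha> k"] \<alpha>_mono by (metis max.cobounded1 max.cobounded2)
  then show ?thesis using assms(1) disjoint \<beta>_B unfolding kept_def by blast
qed

lemma enters_B:
  assumes "n \<in> B" "kept m n"
  shows "\<exists>t\<ge>m. kept t n \<and> n \<in> \<beta> (Suc t)"
proof -
  obtain u where "n \<in> \<beta> u" using B_\<beta> assms(1) by blast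
  moreover have "\<not> n \<in> \<beta> m" using assms(2) by (simp add: kept_def)
  ultimately obtain t where "t \<ge> m" "\<not> n \<in> \<beta> t" "n \<in> \<beta> (Suc t)"
    using dec_induct[of m "max m u" "\<lambda>k. \<not> n \<in> \<beta> k"] \<beta>_mono by (metis max.cobounded1 max.cobounded2)
  then show ?thesis using assms(1) disjoint \<alpha>_A unfolding kept_def by blast
qed

text \<open>Each of the finitely many numbers below \<open>b\<close> outside \<open>R\<close> leaves
  at some stage and never returns. Later on this excludes hits at small numbers.\<close>

lemma settled: "\<exists>s. \<forall>m\<ge>s. \<forall>n<b. kept m n \<longrightarrow> n \<in> R"
proof (induction b)
  case (Suc b)
  then obtain s where s: "\<forall>m\<ge>s. \<forall>n<b. kept m n \<longrightarrow> n \<in> R" by blast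
  obtain u where u: "\<not> kept u b \<or> b \<in> R" using not_R by blast
  have "\<forall>m\<ge>max s u. \<forall>n<Suc b. kept m n \<longrightarrow> n \<in> R"
    using s u kept_mono by (metis less_SucE max.boundedE)
  then show ?case by blast
qed simp

text \<open>The condition on changes is invariant under complement, so the complements approximate
  \<open>- limit\<close> and it has c.e. degree as well.\<close>

lemma splittableI:
  assumes Y: "permanent_changes Y" "decidable_in {} (\<lambda>z. psnd z \<in> Y (pfst z))"
    and \<alpha>: "\<And>m. \<alpha> m \<subseteq> Y m" and \<beta>: "\<And>m. \<beta> m \<inter> Y m = {}"
    and inf: "infinite (R \<inter> permanent_changes.limit Y)" "infinite (R - permanent_changes.limit Y)"
  shows "splittable A B"
proof -
  interpret permanent_changes Y by fact
  interpret co: permanent_changes "\<lambda>m. - Y m"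
  proof
    fix p m assume "(p \<in> - Y m) \<noteq> (p \<in> - Y (Suc m))"
    with change[of p m] show "\<exists>q\<le>p. (q \<in> - Y m) \<noteq> (q \<in> - Y (Suc m)) \<and>
        (\<forall>t>m. (q \<in> - Y t) = (q \<in> - Y (Suc m)))"
      unfolding Compl_iff by blast
  qed
  have "p \<in> co.limit \<longleftrightarrow> p \<notin> limit" for p
  proof -
    obtain s u where s: "\<forall>t\<ge>s. p \<in> Y t \<longleftrightarrow> p \<in> limit" and u: "\<forall>t\<ge>u. p \<in> - Y t \<longleftrightarrow> p \<in> co.limit"
      using eventually_limit co.eventually_limit by blast
    from s have "p \<in> Y (max s u) \<longleftrightarrow> p \<in> limit" by (meson max.cobounded1)
    moreover from u have "p \<in> - Y (max s u) \<longleftrightarrow> p \<in> co.limit" by (meson max.cobounded2)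
    ultimately show ?thesis by blast
  qed
  then have co: "co.limit = - limit" by blast
  have "of_ce_degree limit" by (rule of_ce_degree_limit) fact
  moreover have "of_ce_degree (- limit)"
    unfolding co[symmetric]
  proof (rule co.of_ce_degree_limit)
    show "decidable_in {} (\<lambda>z. psnd z \<in> - Y (pfst z))"
      unfolding Compl_iff by (intro computable_intros Y)
  qed
  moreover have A: "A \<subseteq> limit"
  proof
    fix n assume "n \<in> A"
    then obtain m where "n \<in> \<alpha> m" using A_\<alpha> by blast
    then show "n \<in> limit" using \<alpha> \<alpha>_mono unfolding limit_def by blast
  qed
  moreover have B: "B \<subseteq> - limit"
  proof
    fix n assume "n \<in> B"
    then obtain m where "n \<in> \<beta> m" using B_\<beta> by blast
    then have "\<forall>t\<ge>m. n \<notin> Y t" using \<beta> \<beta>_mono by blast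
    then show "n \<in> - limit" unfolding limit_def by (auto intro: max.cobounded1 max.cobounded2)
  qed
  moreover have "limit - A = R \<inter> limit" "- limit - B = R - limit"
    using A B by (auto simp: R_def)
  ultimately show ?thesis
    unfolding splittable_def using inf by metis
qed

end

subsection \<open>The phase construction\<close>


context enumerated_pair
begin

text \<open>The code \<open>c\<close> lists, for each \<open>n < m\<close>, the pair of its phase
  and its flag. The condition says that phase \<open>j\<close> is still unsatisfied; the least such
  phase is the one that absorbs.\<close>

definition level_ok :: "nat \<Rightarrow> nat \<Rightarrow> nat \<Rightarrow> bool" where
  "level_ok m c j \<longleftrightarrow>
    (\<forall>n<m. kept m n \<and> pfst (look c n) = j \<longrightarrow> psnd (look c n) \<noteq> j mod 2)"

definition level :: "nat \<Rightarrow> nat \<Rightarrow> nat" where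
  "level m c = (LEAST j. level_ok m c j)"

definition next_phase :: "nat \<Rightarrow> nat \<Rightarrow> nat \<Rightarrow> nat" where
  "next_phase m c n = (if n < m then min (pfst (look c n)) (level m c) else level m c)"

text \<open>Flag 1 puts a number into the separator and flag 0 keeps it out, so flag 0 is refuted by
  entering \<open>A\<close> and flag 1 by entering \<open>B\<close>.\<close>

definition code_hit :: "nat \<Rightarrow> nat \<Rightarrow> nat \<Rightarrow> bool" where
  "code_hit m c q \<longleftrightarrow> q < m \<and> kept m q \<and>
    (q \<in> \<alpha> (Suc m) \<and> psnd (look c q) = 0 \<or> q \<in> \<beta> (Suc m) \<and> psnd (look c q) = 1)"

text \<open>Admitting \<open>q = n\<close> makes the search total; the result is below
  \<open>n\<close> iff some smaller number is hit.\<close>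

definition first_hit :: "nat \<Rightarrow> nat \<Rightarrow> nat \<Rightarrow> nat" where
  "first_hit m c n = (LEAST q. q = n \<or> code_hit m c q)"

definition next_flag :: "nat \<Rightarrow> nat \<Rightarrow> nat \<Rightarrow> nat" where
  "next_flag m c n = (if n < m
    then if first_hit m c n < n then next_phase m c (first_hit m c n) mod 2 else psnd (look c n)
    else 0)"

primrec state :: "nat \<Rightarrow> nat" where
  "state 0 = 0"
| "state (Suc m) =
    table (\<lambda>n. pair (next_phase m (state m) n) (next_flag m (state m) n)) (Suc m)"

section \<open>Computability of the construction\<close>

lemma decidable_\<alpha>:
  "computable_in {} f \<Longrightarrow> computable_in {} g \<Longrightarrow> decidable_in {} (\<lambda>e. g e \<in> \<alpha> (f e))"
  using computable_in_app2[of "{}" "\<lambda>a b. of_bool (b \<in> \<alpha> a)"] enum_A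
  by (simp only: enumeration_def)

lemma decidable_\<beta>:
  "computable_in {} f \<Longrightarrow> computable_in {} g \<Longrightarrow> decidable_in {} (\<lambda>e. g e \<in> \<beta> (f e))"
  using computable_in_app2[of "{}" "\<lambda>a b. of_bool (b \<in> \<beta> a)"] enum_B
  by (simp only: enumeration_def)

lemma decidable_kept:
  "computable_in {} f \<Longrightarrow> computable_in {} g \<Longrightarrow> decidable_in {} (\<lambda>e. kept (f e) (g e))"
  unfolding kept_def by (intro computable_intros decidable_\<alpha> decidable_\<beta>)

lemma level_ok_ex: "\<exists>j. level_ok m c j"
proof -
  have "finite ((\<lambda>n. pfst (look c n)) ` {..<m})" by simp
  then obtain j where "j \<notin> (\<lambda>n. pfst (look c n)) ` {..<m}"
    using ex_new_if_finite infinite_UNIV_nat by blast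
  then have "level_ok m c j" by (auto simp: level_ok_def)
  then show ?thesis ..
qed

lemma computable_level:
  assumes "computable_in {} m" "computable_in {} c"
  shows "computable_in {} (\<lambda>e. level (m e) (c e))"
proof -
  have "computable_in {} (\<lambda>z. level (pfst z) (psnd z))"
    unfolding level_def
    by (rule computable_in_Least, unfold level_ok_def,
        intro computable_intros decidable_kept computable_in_look,
        fold level_ok_def, rule level_ok_ex)
  from computable_in_app2[OF this assms] show ?thesis .
qed

lemma computable_next_phase:
  assumes "computable_in {} m" "computable_in {} c" "computable_in {} n"
  shows "computable_in {} (\<lambda>e. next_phase (m e) (c e) (n e))"
  unfolding next_phase_def
  by (intro computable_intros computable_level computable_in_look assms)

lemma computable_first_hit:
  assumes "computable_in {} m" "computable_in {} c" "computable_in {} n"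
  shows "computable_in {} (\<lambda>e. first_hit (m e) (c e) (n e))"
proof -
  have "computable_in {} (\<lambda>z. first_hit (pfst z) (pfst (psnd z)) (psnd (psnd z)))"
    unfolding first_hit_def code_hit_def
    by (rule computable_in_Least,
        intro computable_intros decidable_kept decidable_\<alpha> decidable_\<beta> computable_in_look)
       blast
  from computable_in_app3[OF this assms] show ?thesis .
qed

lemma computable_next_flag:
  assumes "computable_in {} m" "computable_in {} c" "computable_in {} n"
  shows "computable_in {} (\<lambda>e. next_flag (m e) (c e) (n e))"
  unfolding next_flag_def
  by (intro computable_intros computable_first_hit computable_next_phase computable_in_look assms)

lemma computable_state: "computable_in {} f \<Longrightarrow> computable_in {} (\<lambda>e. state (f e))"
proof -
  assume f: "computable_in {} f"
  have "state m = rec_nat 0 (\<lambda>m c. table (\<lambda>n. pair (next_phase m c n) (next_flag m c n)) (Suc m)) m"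
    for m by (induction m) auto
  moreover have "computable_in {} (\<lambda>e. rec_nat 0
      (\<lambda>m c. table (\<lambda>n. pair (next_phase m c n) (next_flag m c n)) (Suc m)) (f e))"
    by (intro computable_in_rec computable_in_table computable_intros computable_next_phase
        computable_next_flag f)
  ultimately show ?thesis by (simp only:)
qed

section \<open>How phases and flags evolve along the stages\<close>

definition phase :: "nat \<Rightarrow> nat \<Rightarrow> nat" where
  "phase m n = pfst (look (state m) n)"

definition flag :: "nat \<Rightarrow> nat \<Rightarrow> nat" where
  "flag m n = psnd (look (state m) n)"

definition active :: "nat \<Rightarrow> nat" where
  "active m = level m (state m)"

definition hit :: "nat \<Rightarrow> nat \<Rightarrow> bool" where
  "hit m q \<longleftrightarrow> code_hit m (state m) q"

lemma hit_iff: "hit m q \<longleftrightarrow> q < m \<and> kept m q \<and>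
    (q \<in> \<alpha> (Suc m) \<and> flag m q = 0 \<or> q \<in> \<beta> (Suc m) \<and> flag m q = 1)"
  by (simp add: hit_def code_hit_def flag_def)

lemma computable_flag:
  "computable_in {} f \<Longrightarrow> computable_in {} g \<Longrightarrow> computable_in {} (\<lambda>e. flag (f e) (g e))"
  unfolding flag_def by (intro computable_intros computable_in_look computable_state)

lemma computable_active:
  "computable_in {} f \<Longrightarrow> computable_in {} (\<lambda>e. active (f e))"
  unfolding active_def by (intro computable_level computable_state)

lemma flag_ge: "m \<le> n \<Longrightarrow> flag m n = 0"
  by (cases m) (auto simp: flag_def)

lemma phase_Suc: "n < m \<Longrightarrow> phase (Suc m) n = min (phase m n) (active m)"
  by (simp add: phase_def active_def next_phase_def)

lemma phase_new: "phase (Suc m) m = active m"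
  by (simp add: phase_def active_def next_phase_def)

lemma flag_unhit:
  assumes "\<And>q. q < n \<Longrightarrow> \<not> hit m q"
  shows "flag (Suc m) n = flag m n"
proof (cases "n < m")
  case True
  have "first_hit m (state m) n = n"
    unfolding first_hit_def
    by (rule Least_equality) (use assms in \<open>auto simp: hit_def intro: leI\<close>)
  with True show ?thesis by (simp add: flag_def next_flag_def)
next
  case False
  then show ?thesis by (cases "n = m") (auto simp: flag_ge, simp add: flag_def next_flag_def)
qed

text \<open>The least hit of a stage decides the new flags of all present numbers above it. Its
  minimality is recorded because it protects the numbers below it from hits at this stage.\<close>

lemma flag_hit:
  assumes "hit m q" "q < n" "n < m"
  shows "\<exists>q'\<le>q. hit m q' \<and> (\<forall>p<q'. \<not> hit m p) \<and> flag (Suc m) n = phase (Suc m) q' mod 2"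
proof -
  let ?q = "first_hit m (state m) n"
  have le: "?q \<le> q"
    unfolding first_hit_def using assms by (intro Least_le) (simp add: hit_def)
  have "?q = n \<or> code_hit m (state m) ?q"
    unfolding first_hit_def by (rule LeastI[of "\<lambda>q. q = n \<or> code_hit m (state m) q" n]) simp
  with le assms have hit: "hit m ?q" by (auto simp: hit_def)
  have min: "\<not> hit m p" if "p < ?q" for p
    using that not_less_Least[of p "\<lambda>q. q = n \<or> code_hit m (state m) q"]
    by (simp add: hit_def first_hit_def)
  have "?q < m" "?q < n" using le assms by auto
  then have "flag (Suc m) n = phase (Suc m) ?q mod 2"
    using assms by (simp add: flag_def phase_def next_flag_def)
  with le hit min show ?thesis by blast
qed

lemma flag_new: "flag (Suc m) m = 0"
  by (simp add: flag_def next_flag_def)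

lemma flag_le_1: "flag m n \<le> 1"
proof (induction m)
  case 0
  show ?case by (simp add: flag_ge)
next
  case (Suc m)
  consider "\<exists>q<n. hit m q" "n < m" | "\<forall>q<n. \<not> hit m q" | "m \<le> n" by fastforce
  then show ?case
  proof cases
    case 1
    then obtain q where "flag (Suc m) n = phase (Suc m) q mod 2" using flag_hit by blast
    then show ?thesis by simp
  next
    case 2
    with Suc show ?thesis by (simp add: flag_unhit)
  next
    case 3
    then show ?thesis by (cases "n = m") (auto simp: flag_ge flag_new)
  qed
qed

lemma active_ok:
  "n < m \<Longrightarrow> kept m n \<Longrightarrow> phase m n = active m \<Longrightarrow> flag m n \<noteq> active m mod 2"
  using LeastI_ex[OF level_ok_ex, of m "state m"]
  by (simp add: level_ok_def active_def level_def flag_def phase_def)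

lemma less_active:
  "j < active m \<Longrightarrow> \<exists>n<m. kept m n \<and> phase m n = j \<and> flag m n = j mod 2"
  using not_less_Least[of j "level_ok m (state m)"]
  by (auto simp: level_ok_def active_def level_def flag_def phase_def)

text \<open>Capping by the active phase preserves order, and the newest number receives the cap
  itself. Hence the phases are consecutive intervals.\<close>

lemma phase_mono: "n \<le> n' \<Longrightarrow> n' < m \<Longrightarrow> phase m n \<le> phase m n'"
proof (induction m)
  case (Suc m)
  consider "n = n'" | "n < n'" "n' = m" | "n' < m" using Suc.prems by linarith
  then show ?case
  proof cases
    case 3
    then show ?thesis using Suc by (simp add: phase_Suc min.coboundedI1)
  qed (use phase_Suc phase_new in auto)
qed simp

lemma phase_antimono: "m \<le> m' \<Longrightarrow> n < m \<Longrightarrow> phase m' n \<le> phase m n"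
  by (induction rule: dec_induct) (auto simp: phase_Suc)

lemma phase_le_active: "n \<le> m \<Longrightarrow> m < m' \<Longrightarrow> phase m' n \<le> active m"
proof -
  assume n: "n \<le> m" and m: "m < m'"
  have "phase (Suc m) n \<le> active m"
    using n by (cases "n = m") (auto simp: phase_Suc phase_new)
  then show ?thesis using phase_antimono[of "Suc m" m' n] n m by linarith
qed

text \<open>A number \<open>n \<ge> s\<close> is created at stage \<open>n\<close> in the active
  phase, and from then on it is only capped by values that are at least \<open>i\<close>.\<close>

lemma phase_ge:
  assumes "\<And>m. m \<ge> s \<Longrightarrow> i \<le> active m" "s \<le> n" "n < m"
  shows "i \<le> phase m n"
  using assms(3)
proof (induction m)
  case (Suc m)
  then show ?case using assms by (cases "n = m") (auto simp: phase_Suc phase_new)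
qed simp

lemma hit_not_R: "hit m q \<Longrightarrow> q \<notin> R"
  unfolding hit_iff using R_kept kept_def by blast

definition Y :: "nat \<Rightarrow> nat set" where
  "Y m = {n. n \<in> \<alpha> m \<or> kept m n \<and> flag m n = 1}"

text \<open>A number that has left \<open>kept\<close> never changes again. If \<open>p\<close>
  changes while it stays kept, its flag was altered by a hit below it, and the hit number itself
  changes sides and leaves.\<close>

lemma permanent_changes_Y: "permanent_changes Y"
proof
  fix p m assume p: "(p \<in> Y m) \<noteq> (p \<in> Y (Suc m))"
  have leave: "q \<in> Y t \<longleftrightarrow> q \<in> Y (Suc m)" if "\<not> kept (Suc m) q" "t > m" for q t
    using that \<alpha>_mono[of "Suc m" t q] \<beta>_mono[of "Suc m" t q] \<alpha>_\<beta>[of q] unfolding Y_def kept_def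
    by (auto simp: Suc_le_eq)
  show "\<exists>q\<le>p. (q \<in> Y m) \<noteq> (q \<in> Y (Suc m)) \<and> (\<forall>t>m. (q \<in> Y t) = (q \<in> Y (Suc m)))"
  proof (cases "kept (Suc m) p")
    case False
    then show ?thesis using p leave by blast
  next
    case True
    then have "flag (Suc m) p \<noteq> flag m p"
      using p kept_mono[OF True, of m] by (auto simp: Y_def kept_def)
    then obtain q where q: "q < p" "hit m q" using flag_unhit by blast
    then have "\<not> kept (Suc m) q" by (auto simp: hit_iff kept_def)
    moreover have "(q \<in> Y m) \<noteq> (q \<in> Y (Suc m))"
      using q(2) \<alpha>_\<beta>[of q] by (auto simp: hit_iff Y_def kept_def)
    ultimately show ?thesis using q(1) leave less_imp_le by blast
  qed
qed

text \<open>Each phase \<open>i\<close> is eventually satisfied at every stage, and a single number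
  \<open>g i\<close> serves it infinitely often. So \<open>g i\<close> lies in \<open>R\<close>, and
  its side in the limit is the parity of \<open>i\<close>.\<close>

lemma splittable_if_active_unbounded:
  assumes "\<And>i. \<exists>s. \<forall>m\<ge>s. active m \<noteq> i"
  shows "splittable A B"
proof -
  interpret Y: permanent_changes Y by (rule permanent_changes_Y)
  have gt: "\<exists>s. \<forall>m\<ge>s. i < active m" for i
  proof (induction i)
    case 0
    then show ?case using assms[of 0] by blast
  next
    case (Suc i)
    then obtain s where s: "\<forall>m\<ge>s. i < active m" by blast
    obtain u where u: "\<forall>m\<ge>u. active m \<noteq> Suc i" using assms by blast
    have "Suc i < active m" if "m \<ge> max s u" for m
    proof -
      have "i < active m" "active m \<noteq> Suc i" using s u that by auto
      then show ?thesis by linarith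
    qed
    then show ?case by blast
  qed
  let ?P = "\<lambda>i n m. kept m n \<and> phase m n = i \<and> flag m n = i mod 2"
  have "\<exists>n. infinite {m. n < m \<and> ?P i n m}" for i
  proof -
    obtain s where s: "\<And>m. m \<ge> s \<Longrightarrow> Suc i \<le> active m" using gt[of i] Suc_leI by blast
    \<comment> \<open>Pigeonhole: numbers from \<open>s\<close> on only get phases beyond
      \<open>i\<close>, so at every late stage one of the finitely many numbers below
      \<open>s\<close> serves phase \<open>i\<close>.\<close>
    have "{s..} \<subseteq> (\<Union>n<s. {m. n < m \<and> ?P i n m})"
    proof
      fix m assume "m \<in> {s..}"
      then have m: "s \<le> m" by simp
      then obtain n where n: "n < m" "?P i n m" using less_active[of i m] s[OF m] by auto
      have "n < s"
      proof (rule ccontr)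
        assume "\<not> n < s"
        then have "Suc i \<le> phase m n" using phase_ge[of s "Suc i" n m] s n by simp
        with n show False by simp
      qed
      with n show "m \<in> (\<Union>n<s. {m. n < m \<and> ?P i n m})" by blast
    qed
    then have "infinite (\<Union>n<s. {m. n < m \<and> ?P i n m})"
      using infinite_Ici infinite_super by blast
    then show ?thesis by blast
  qed
  then have "\<forall>i. \<exists>n. infinite {m. n < m \<and> ?P i n m}" ..
  from choice[OF this] obtain g where g: "\<forall>i. infinite {m. g i < m \<and> ?P i (g i) m}" ..
  have often: "\<exists>m\<ge>s. g i < m \<and> ?P i (g i) m" for i s
    using g unfolding infinite_nat_iff_unbounded_le by blast
  have "g i \<in> R" for i
    using often[of _ i] not_R[of "g i"] kept_mono by blast
  moreover have "g i \<in> Y.limit \<longleftrightarrow> odd i" for i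
  proof -
    obtain s where s: "\<forall>t\<ge>s. g i \<in> Y t \<longleftrightarrow> g i \<in> Y.limit" using Y.eventually_limit by blast
    obtain m where m: "m \<ge> s" "?P i (g i) m" using often by blast
    then have "g i \<in> Y m \<longleftrightarrow> odd i"
      by (auto simp: Y_def kept_def odd_iff_mod_2_eq_one)
    with s m(1) show ?thesis by blast
  qed
  moreover have "inj g"
  proof (rule injI)
    \<comment> \<open>The phase of a fixed number never increases, while both \<open>i\<close> and
      \<open>i'\<close> recur as its phase.\<close>
    have "i' \<le> i" if "g i = g i'" for i i'
    proof -
      obtain m where m: "g i < m" "?P i (g i) m" using often[of 0 i] by blast
      obtain m' where "m' \<ge> m" "?P i' (g i') m'" using often by blast
      with m that phase_antimono[of m m' "g i"] show ?thesis by simp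
    qed
    then show "i = i'" if "g i = g i'" for i i' using that by (metis antisym)
  qed
  moreover have "infinite {i::nat. odd i}" "infinite {i::nat. even i}"
  proof -
    have "\<exists>n\<ge>m. odd n" "\<exists>n\<ge>m. even n" for m :: nat
      by (rule exI[of _ "Suc (2 * m)"], simp, rule exI[of _ "2 * m"], simp)
    then show "infinite {i::nat. odd i}" "infinite {i::nat. even i}"
      by (auto simp: infinite_nat_iff_unbounded_le)
  qed
  ultimately have sub: "g ` {i. odd i} \<subseteq> R \<inter> Y.limit" "g ` {i. even i} \<subseteq> R - Y.limit"
    and "infinite (g ` {i. odd i})" "infinite (g ` {i. even i})"
    by (auto simp: finite_image_iff inj_on_def)
  then have "infinite (R \<inter> Y.limit)" "infinite (R - Y.limit)"
    using infinite_super by blast+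
  then show ?thesis
  proof (rule splittableI[OF permanent_changes_Y, rotated 3])
    show "decidable_in {} (\<lambda>z. psnd z \<in> Y (pfst z))"
      unfolding Y_def mem_Collect_eq
      by (intro computable_intros decidable_\<alpha> decidable_kept computable_flag)
    show "\<alpha> m \<subseteq> Y m" for m by (auto simp: Y_def)
    show "\<beta> m \<inter> Y m = {}" for m using \<alpha>_\<beta> by (auto simp: Y_def kept_def)
  qed
qed

end

subsection \<open>Doomed elements\<close>


context enumerated_pair
begin

text \<open>Contrapositive reading: when a number \<open>q \<ge> c\<close> still kept at stage
  \<open>m\<close> enters \<open>D\<close> later, everything in \<open>(q, m]\<close> leaves
  \<open>R\<close>.\<close>

definition doomed :: "nat set \<Rightarrow> nat \<Rightarrow> bool" where
  "doomed D c \<longleftrightarrow> (\<forall>m q r. c \<le> q \<longrightarrow> q < r \<longrightarrow> r \<le> m \<longrightarrow> kept m q \<longrightarrow> r \<in> R \<longrightarrow> q \<notin> D)"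

text \<open>\<open>i\<close> is the limit inferior of \<open>active\<close>; it is finite, since
  otherwise the construction would split the pair.\<close>

lemma active_recurrent:
  assumes "\<not> splittable A B"
  shows "\<exists>i s. (\<forall>m\<ge>s. i \<le> active m) \<and> (\<forall>u. \<exists>m\<ge>u. active m = i)"
proof -
  let ?P = "\<lambda>i. \<forall>u. \<exists>m\<ge>u. active m = i"
  have "\<exists>i. ?P i" using splittable_if_active_unbounded assms by blast
  then obtain i where i: "?P i" "\<And>j. j < i \<Longrightarrow> \<not> ?P j"
    using exists_least_iff[of ?P] by blast
  have "\<exists>s. \<forall>m\<ge>s. j \<le> active m" if "j \<le> i" for j
    using that
  proof (induction j)
    case (Suc j)
    then obtain s where s: "\<forall>m\<ge>s. j \<le> active m" by auto
    obtain u where u: "\<forall>m\<ge>u. active m \<noteq> j" using i(2)[of j] Suc.prems by auto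
    have "Suc j \<le> active m" if "m \<ge> max s u" for m
    proof -
      have "j \<le> active m" "active m \<noteq> j" using s u that by auto
      then show ?thesis by linarith
    qed
    then show ?case by blast
  qed simp
  with i(1) show ?thesis by blast
qed

section \<open>The least phase that is active infinitely often\<close>

context
  fixes i s
  assumes ge: "\<And>m. m \<ge> s \<Longrightarrow> i \<le> active m"
    and rec: "\<And>u. \<exists>m\<ge>u. active m = i"
begin

text \<open>When phase \<open>i\<close> is active at \<open>m0\<close> it absorbs all numbers up to
  \<open>m0\<close> that lie beyond it, and numbers from \<open>s\<close> on never drop below
  it.\<close>

lemma phase_eq:
  assumes "active m0 = i" "s \<le> n" "n \<le> m0" "m0 < m"
  shows "phase m n = i"
proof (rule antisym)
  show "phase m n \<le> i" using phase_le_active[of n m0 m] assms by simp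
  show "i \<le> phase m n" using phase_ge[of s i n m] ge assms by simp
qed

text \<open>Inside the window up to \<open>m0\<close>, hitting \<open>q\<close> flags everything above \<open>q\<close> with the parity of \<open>i\<close>,
  and such a flag can never be reverted; a flagged element of \<open>R\<close> would prevent phase \<open>i\<close> from
  being active again.\<close>

lemma window:
  "\<exists>c. \<forall>m0 t q r. active m0 = i \<longrightarrow> active t = i \<longrightarrow> m0 < t \<longrightarrow> c \<le> t \<longrightarrow> c \<le> q \<longrightarrow> q < r \<longrightarrow>
     r \<le> m0 \<longrightarrow> kept t q \<longrightarrow> r \<in> R \<longrightarrow> q \<notin> (if even i then B else A)"
proof -
  \<comment> \<open>From \<open>s1\<close> on, the kept numbers below \<open>s\<close> belong to
    \<open>R\<close> and are never hit, so every hit happens at or above \<open>s\<close>, where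
    phases are known.\<close>
  obtain s1 where s1: "\<And>m n. m \<ge> s1 \<Longrightarrow> n < s \<Longrightarrow> kept m n \<Longrightarrow> n \<in> R" using settled by blast
  have "q \<notin> (if even i then B else A)"
    if m0: "active m0 = i" and t: "active t = i" "m0 < t" "max s s1 \<le> t" and q: "max s s1 \<le> q" "q < r"
      and r: "r \<le> m0" "r \<in> R" and kq: "kept t q" for m0 t q r
  proof
    assume D: "q \<in> (if even i then B else A)"
    have effect: "flag (Suc m) r = i mod 2" if m: "t \<le> m" and p: "hit m p" "p < r" for m p
    proof -
      obtain p' where p': "p' \<le> p" "hit m p'" "flag (Suc m) r = phase (Suc m) p' mod 2"
        using flag_hit[OF p] m t r by auto
      have "s \<le> p'"
      proof (rule ccontr)
        assume "\<not> s \<le> p'"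
        then have "p' \<in> R" using s1[of m p'] m t p'(2) by (auto simp: hit_iff)
        then show False using hit_not_R p'(2) by blast
      qed
      then have "phase (Suc m) p' = i"
        using phase_eq[OF m0, of p' "Suc m"] p' p m t r by simp
      with p' show ?thesis by simp
    qed
    \<comment> \<open>A hit below \<open>r\<close> would give \<open>r\<close> the flag
      \<open>i mod 2\<close> forever, and phase \<open>i\<close>, which contains \<open>r\<close>,
      could not be active again.\<close>
    have nohit: "\<not> hit m p" if m: "t \<le> m" and p: "p < r" for m p
    proof
      assume hit: "hit m p"
      have stays: "flag m' r = i mod 2" if "Suc m \<le> m'" for m'
        using that
      proof (induction rule: dec_induct)
        case base
        show ?case by (rule effect[OF m hit p])
      next
        case (step n)
        show ?case
        proof (cases "\<exists>p<r. hit n p")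
          case True
          then show ?thesis using effect[of n] step m by auto
        next
          case False
          then show ?thesis using flag_unhit[of r n] step by auto
        qed
      qed
      obtain m' where m': "m' \<ge> Suc m" "active m' = i" using rec by blast
      have "phase m' r = i" using phase_eq[OF m0, of r m'] m' m t r q by simp
      then have "flag m' r \<noteq> i mod 2"
        using active_ok[of r m'] m' m t r R_kept by simp
      then show False using stays m' by simp
    qed
    \<comment> \<open>At the active stage \<open>t\<close> the flag of \<open>q\<close> is opposite
      to what phase \<open>i\<close> wants. With no hits below \<open>r\<close> it stays so, and
      entering the set in question would itself be a hit.\<close>
    have "flag t q \<noteq> i mod 2"
      using active_ok[of q t] t q r kq phase_eq[OF m0, of q t] by simp
    then have "flag t q = (if even i then 1 else 0)"
      using flag_le_1[of t q] by (cases "even i") (auto simp: even_iff_mod_2_eq_zero odd_iff_mod_2_eq_one)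
    moreover have same: "flag m q = flag t q" if "t \<le> m" for m
      using that
    proof (induction rule: dec_induct)
      case (step n)
      then show ?case using flag_unhit[of q n] nohit[of n] q by simp
    qed simp
    ultimately have flag: "flag m q = (if even i then 1 else 0)" if "t \<le> m" for m
      using that by metis
    obtain m where m: "t \<le> m" "kept m q" "q \<in> (if even i then \<beta> (Suc m) else \<alpha> (Suc m))"
      using D enters_A[OF _ kq] enters_B[OF _ kq] by (auto split: if_splits)
    then have "hit m q" using flag[of m] t q r by (auto simp: hit_iff split: if_splits)
    then show False using nohit m q by blast
  qed
  then show ?thesis by blast
qed

text \<open>Reading the enumerations at stage \<open>\<sigma> n\<close> turns \<open>window\<close>
  into a statement about all \<open>r \<le> n\<close>, which is \<open>doomed\<close> for the faster
  enumerations.\<close>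

lemma speedup:
  "\<exists>\<sigma> c. computable_in {} \<sigma> \<and> mono \<sigma> \<and> (\<forall>n. n \<le> \<sigma> n) \<and>
     (\<forall>n q r. c \<le> q \<longrightarrow> q < r \<longrightarrow> r \<le> n \<longrightarrow> kept (\<sigma> n) q \<longrightarrow> r \<in> R \<longrightarrow>
        q \<notin> (if even i then B else A))"
proof -
  obtain c where c: "\<And>m0 t q r. \<lbrakk>active m0 = i; active t = i; m0 < t; c \<le> t; c \<le> q; q < r;
     r \<le> m0; kept t q; r \<in> R\<rbrakk> \<Longrightarrow> q \<notin> (if even i then B else A)"
    using window by metis
  \<comment> \<open>Two active stages are sought: \<open>m0 \<ge> n\<close> brings the numbers up to
    \<open>n\<close> into the window, and the later \<open>t\<close> guarantees the opposite
    flags.\<close>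
  define P where "P n t \<longleftrightarrow> active t = i \<and> c \<le> t \<and> (\<exists>m0<t. n \<le> m0 \<and> active m0 = i)" for n t
  define \<sigma> where "\<sigma> n = (LEAST t. P n t)" for n
  have ex: "\<exists>t. P n t" for n
  proof -
    obtain m0 where m0: "m0 \<ge> n" "active m0 = i" using rec by blast
    obtain t where "t \<ge> max c (Suc m0)" "active t = i" using rec by blast
    moreover from this have "c \<le> t" "m0 < t" by auto
    ultimately have "P n t" using m0 unfolding P_def by blast
    then show ?thesis ..
  qed
  have P: "P n (\<sigma> n)" for n
    unfolding \<sigma>_def by (rule LeastI_ex[OF ex])
  have "decidable_in {} (\<lambda>z. P (pfst z) (psnd z))"
    unfolding P_def by (intro computable_intros computable_active)
  then have "computable_in {} \<sigma>"
    unfolding \<sigma>_def using ex by (rule computable_in_Least)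
  moreover have "mono \<sigma>"
  proof (rule monoI)
    fix n n' :: nat assume "n \<le> n'"
    then have "P n (\<sigma> n')" using P[of n'] unfolding P_def by (meson order_trans)
    then show "\<sigma> n \<le> \<sigma> n'" unfolding \<sigma>_def by (rule Least_le)
  qed
  moreover have "n \<le> \<sigma> n" for n
    using P[of n] by (auto simp: P_def)
  moreover have "q \<notin> (if even i then B else A)"
    if "c \<le> q" "q < r" "r \<le> n" "kept (\<sigma> n) q" "r \<in> R" for n q r
  proof -
    obtain m0 where "active m0 = i" "m0 < \<sigma> n" "n \<le> m0" "c \<le> \<sigma> n" "active (\<sigma> n) = i"
      using P[of n] by (auto simp: P_def)
    then show ?thesis using c[of m0 "\<sigma> n" q r] that by simp
  qed
  ultimately show ?thesis by blast
qed

text \<open>If \<open>i\<close> is even, then \<open>R\<close> is eventually flagged \<open>1\<close>, so every large \<open>r \<in> R\<close> is last flagged by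
  some hit in an odd phase beyond \<open>i\<close>. At that moment phase \<open>i\<close> contains an element \<open>p\<close> flagged \<open>0\<close>,
  which cannot enter \<open>A\<close> without hitting \<open>r\<close> again, nor enter \<open>B\<close> without dooming \<open>r\<close>.\<close>

lemma odd_if_doomed:
  assumes doomed: "doomed B c" and inf: "infinite R"
  shows "odd i"
proof
  assume i: "even i"
  define c1 where "c1 = max s c"
  obtain s1 where s1: "\<And>m n. m \<ge> s1 \<Longrightarrow> n < c1 \<Longrightarrow> kept m n \<Longrightarrow> n \<in> R" using settled by blast
  \<comment> \<open>With \<open>r \<ge> s1\<close> all stages after \<open>r\<close> are past
    \<open>s1\<close>; with \<open>r \<ge> s\<close> the number \<open>r\<close> ends up in phase
    \<open>i\<close>.\<close>
  obtain r where r: "r \<ge> max c1 s1" "r \<in> R" using inf unfolding infinite_nat_iff_unbounded_le by blast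
  obtain N where N: "\<And>m n. m \<ge> N \<Longrightarrow> n < r \<Longrightarrow> kept m n \<Longrightarrow> n \<in> R" using settled by blast
  have late: "\<not> hit m q" if "m \<ge> N" "q < r" for m q
    using N[OF that] hit_not_R hit_iff by blast
  obtain m0 where m0: "m0 \<ge> r" "active m0 = i" using rec by blast
  obtain m1 where m1: "m1 \<ge> max N (Suc m0)" "active m1 = i" using rec by blast
  have "phase m1 r = i" using phase_eq[of m0 r m1] m0 m1 r by (simp add: c1_def)
  then have m1r: "flag m1 r \<noteq> 0"
    using active_ok[of r m1] m0 m1 R_kept[OF r(2)] i by simp
  \<comment> \<open>These are the only stages that can change the flag of \<open>r\<close> once
    \<open>r\<close> is present.\<close>
  define H where "H = {m. r < m \<and> (\<exists>q<r. hit m q)}"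
  have finH: "finite H"
    by (rule finite_subset[of _ "{..<N}"]) (use late in \<open>auto simp: H_def not_less[symmetric]\<close>)
  have unhit: "flag m' r = flag m r" if "m \<le> m'" "\<And>t. m \<le> t \<Longrightarrow> t < m' \<Longrightarrow> t \<notin> H" "r < m" for m m'
    using that(1,2)
  proof (induction rule: dec_induct)
    case (step n)
    then have "\<And>q. q < r \<Longrightarrow> \<not> hit n q" using that(3) by (auto simp: H_def)
    then show ?case using flag_unhit[of r n] step by simp
  qed simp
  \<comment> \<open>New numbers start with flag 0, whereas \<open>r\<close> has a nonzero flag at
    stage \<open>m1\<close>.\<close>
  have "H \<noteq> {}"
  proof
    assume "H = {}"
    then have "flag m1 r = flag (Suc r) r" using unhit[of "Suc r" m1] m0 m1 by simp
    then show False using m1r by (simp add: flag_new)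
  qed
  define m where "m = Max H"
  have mH: "m \<in> H" and last: "\<And>t. t \<in> H \<Longrightarrow> t \<le> m"
    using \<open>H \<noteq> {}\<close> finH by (auto simp: m_def)
  then obtain q0 where q0: "r < m" "q0 < r" "hit m q0" by (auto simp: H_def)
  then obtain q where q: "q \<le> q0" "hit m q" "\<And>p. p < q \<Longrightarrow> \<not> hit m p"
    "flag (Suc m) r = phase (Suc m) q mod 2" using flag_hit[of m q0 r] by blast
  have "m < N" using late[of m q0] q0 by (meson not_le)
  then have "flag m1 r = flag (Suc m) r"
    using unhit[of "Suc m" m1] last q0 m1 by (metis Suc_leI le_trans less_Suc_eq max.boundedE not_less_eq_eq)
  then have odd: "odd (phase (Suc m) q)"
    using q(4) m1r by (auto simp: odd_iff_mod_2_eq_one)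
  have fresh: "p \<in> R \<or> c1 \<le> p" if "kept m p" for p
    using s1[of m p] that q0 r by (auto simp: not_le)
  have qR: "q \<notin> R" using hit_not_R q(2) by blast
  then have "s \<le> q" using fresh[of q] q(2) by (auto simp: hit_iff c1_def)
  then have "i \<le> phase (Suc m) q" using phase_ge[of s i q "Suc m"] ge q q0 by simp
  then have "i < phase (Suc m) q" using odd i by (metis le_neq_implies_less)
  then have lt: "i < phase m q" "i < active m" using phase_Suc[of q m] q q0 by auto
  \<comment> \<open>Phase \<open>i\<close> lies below the active one, so it is satisfied, and as
    \<open>i\<close> is even its number has flag 0.\<close>
  then obtain p where p: "p < m" "kept m p" "phase m p = i" "flag m p = 0"
    using less_active[of i m] i by auto
  have "p < q"
    using phase_mono[of q p m] p lt by (meson not_le)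
  \<comment> \<open>At stage \<open>m\<close> the least hit is at \<open>q > p\<close>; after stage
    \<open>m\<close> nothing below \<open>r\<close> is hit.\<close>
  have nohit: "\<not> hit t x" if "m \<le> t" "x \<le> p" for t x
  proof (cases "t = m")
    case True
    then show ?thesis using q(3) that \<open>p < q\<close> by simp
  next
    case False
    then have "t \<notin> H" using last[of t] that by auto
    then show ?thesis using that False q0 q \<open>p < q\<close> by (auto simp: H_def)
  qed
  have flag0: "flag t p = 0" if "m \<le> t" for t
    using that
  proof (induction rule: dec_induct)
    case (step n)
    then show ?case using flag_unhit[of p n] nohit[of n] by simp
  qed (rule p)
  have "m \<ge> s" using q0 r by (simp add: c1_def)
  have phase_p: "phase t p = i" if "m \<le> t" for t
    using that
  proof (induction rule: dec_induct)
    case (step n)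
    then show ?case using phase_Suc[of p n] p ge[of n] \<open>m \<ge> s\<close> by simp
  qed (rule p)
  have "p \<notin> R"
  proof
    assume "p \<in> R"
    obtain t where "t \<ge> m" "active t = i" using rec by blast
    then show False
      using active_ok[of p t] phase_p[of t] flag0[of t] p R_kept[OF \<open>p \<in> R\<close>] i by simp
  qed
  then have "c \<le> p" using fresh p by (auto simp: c1_def)
  then have "p \<notin> B"
    using doomed p \<open>p < q\<close> q q0 r unfolding doomed_def by (meson le_less_trans less_imp_le less_trans order_refl)
  then have "p \<in> A" using \<open>p \<notin> R\<close> by (auto simp: R_def)
  then obtain t where t: "t \<ge> m" "kept t p" "p \<in> \<alpha> (Suc t)" using enters_A p by blast
  then have "hit t p" using flag0[of t] p by (auto simp: hit_iff)
  then show False using nohit t by blast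
qed

end

lemma splittable_if_doomed:
  assumes dA: "doomed A c" and dB: "doomed B c" and inf: "infinite R"
  shows "splittable A B"
proof -
  \<comment> \<open>Each \<open>n\<close> is judged by stage \<open>n\<close> alone, which makes
    \<open>C\<close> computable; the count is meaningful only for \<open>n \<in> R\<close>.\<close>
  define C where "C = {n. (\<Sum>q<n. of_bool (c \<le> q \<and> kept n q)) mod 2 = (0::nat)}"
  define S where "S n = {q\<in>R. c \<le> q \<and> q < n}" for n
  have C_R: "n \<in> C \<longleftrightarrow> even (card (S n))" if "n \<in> R" for n
  proof -
    \<comment> \<open>A number \<open>q\<close> kept at stage \<open>n\<close> below
      \<open>n \<in> R\<close> enters neither \<open>A\<close> nor \<open>B\<close>, as both are
      doomed.\<close>
    have "kept n q \<longleftrightarrow> q \<in> R" if "c \<le> q" "q < n" for q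
      using dA dB that \<open>n \<in> R\<close> R_kept unfolding doomed_def R_def by blast
    then have "(\<Sum>q<n. of_bool (c \<le> q \<and> kept n q)) = (\<Sum>q<n. of_bool (q \<in> S n) :: nat)"
      by (intro sum.cong refl) (auto simp: S_def)
    also have "\<dots> = card (S n)"
    proof -
      have "{..<n} \<inter> S n = S n" by (auto simp: S_def)
      then show ?thesis by (simp add: sum.If_cases of_bool_def)
    qed
    finally show ?thesis by (simp add: C_def even_iff_mod_2_eq_zero)
  qed
  \<comment> \<open>Consecutive elements of \<open>R\<close> have counts that differ by one, hence
    opposite parities.\<close>
  have "\<exists>n\<ge>m. \<exists>n'\<ge>m. n \<in> R \<and> n' \<in> R \<and> n \<in> C \<and> n' \<notin> C" for m
  proof -
    obtain a where a: "a \<ge> max m c" "a \<in> R" using inf unfolding infinite_nat_iff_unbounded_le by blast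
    have ex: "\<exists>b. b > a \<and> b \<in> R" using inf unfolding infinite_nat_iff_unbounded by blast
    define b where "b = (LEAST b. b > a \<and> b \<in> R)"
    have b: "b > a" "b \<in> R" using LeastI_ex[OF ex] by (auto simp: b_def)
    have "\<not> (a < q \<and> q \<in> R)" if "q < b" for q
      using not_less_Least that unfolding b_def by blast
    then have "S b = insert a (S a)"
      using a b by (auto simp: S_def) (metis linorder_neqE_nat)
    moreover have "finite (S a)" "a \<notin> S a" by (auto simp: S_def)
    ultimately have "card (S b) = Suc (card (S a))" by simp
    then have "a \<in> C \<longleftrightarrow> b \<notin> C" using C_R a b by simp
    moreover have "m \<le> a" "m \<le> b" using a b by auto
    ultimately show ?thesis using a(2) b(2) by blast
  qed
  then have RC: "infinite (R \<inter> C)" "infinite (R - C)"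
    unfolding infinite_nat_iff_unbounded_le by (metis IntI, metis DiffI)
  \<comment> \<open>As \<open>C\<close> does not depend on the stage, a number changes sides only
    when it leaves \<open>kept\<close>, and then for good.\<close>
  define Z where "Z m = {n. n \<in> \<alpha> m \<or> kept m n \<and> n \<in> C}" for m
  have Z: "permanent_changes Z"
  proof
    fix p m assume p: "(p \<in> Z m) \<noteq> (p \<in> Z (Suc m))"
    then have *: "\<not> kept (Suc m) p"
      unfolding Z_def kept_def using \<alpha>_mono[of m "Suc m" p] \<beta>_mono[of m "Suc m" p] by auto
    have "p \<in> Z t \<longleftrightarrow> p \<in> Z (Suc m)" if "t > m" for t
      using * that \<alpha>_mono[of "Suc m" t p] \<beta>_mono[of "Suc m" t p] \<alpha>_\<beta>[of p] unfolding Z_def kept_def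
      by (auto simp: Suc_le_eq)
    with p show "\<exists>q\<le>p. (q \<in> Z m) \<noteq> (q \<in> Z (Suc m)) \<and> (\<forall>t>m. (q \<in> Z t) = (q \<in> Z (Suc m)))"
      by blast
  qed
  interpret Z: permanent_changes Z by (rule Z)
  have "n \<in> Z.limit \<longleftrightarrow> n \<in> C" if "n \<in> R" for n
    using R_kept[OF that] unfolding Z.limit_def Z_def kept_def by auto
  then have "R \<inter> Z.limit = R \<inter> C" "R - Z.limit = R - C" by auto
  with RC have "infinite (R \<inter> Z.limit)" "infinite (R - Z.limit)" by auto
  then show ?thesis
  proof (rule splittableI[OF Z, rotated 3])
    show "decidable_in {} (\<lambda>z. psnd z \<in> Z (pfst z))"
      unfolding Z_def C_def mem_Collect_eq
      by (intro computable_intros decidable_\<alpha> decidable_kept)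
    show "\<alpha> m \<subseteq> Z m" for m by (auto simp: Z_def)
    show "\<beta> m \<inter> Z m = {}" for m using \<alpha>_\<beta> by (auto simp: Z_def kept_def)
  qed
qed

end

section \<open>Speeding up and combining the two cases\<close>

context enumerated_pair
begin

lemma enumerated_pair_speedup:
  assumes "computable_in {} \<sigma>" "mono \<sigma>" "\<And>n. n \<le> \<sigma> n"
  shows "enumerated_pair A B (\<lambda>n. \<alpha> (\<sigma> n)) (\<lambda>n. \<beta> (\<sigma> n))"
  using enumeration_speedup[OF enum_A assms] enumeration_speedup[OF enum_B assms] disjoint
  by unfold_locales

text \<open>If the pair is not splittable, the recurrent phase must be odd, so a further speedup
  dooms \<open>A\<close> while \<open>B\<close> stays doomed. With both doomed the pair is
  splittable after all.\<close>

lemma splittable_if_doomed_B: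
  assumes doomed: "doomed B c" and inf: "infinite R"
  shows "splittable A B"
proof (rule ccontr)
  assume ns: "\<not> splittable A B"
  obtain i s where i: "\<And>m. m \<ge> s \<Longrightarrow> i \<le> active m" "\<And>u. \<exists>m\<ge>u. active m = i"
    using active_recurrent[OF ns] by blast
  have "odd i" using odd_if_doomed[of s i, OF i doomed inf] .
  then obtain \<sigma> c' where \<sigma>: "computable_in {} \<sigma>" "mono \<sigma>" "\<And>n. n \<le> \<sigma> n"
    and dA: "\<And>n q r. \<lbrakk>c' \<le> q; q < r; r \<le> n; kept (\<sigma> n) q; r \<in> R\<rbrakk> \<Longrightarrow> q \<notin> A"
    using speedup[of s i, OF i] unfolding if_not_P[OF \<open>odd i\<close>] by metis
  interpret Q: enumerated_pair A B "\<lambda>n. \<alpha> (\<sigma> n)" "\<lambda>n. \<beta> (\<sigma> n)"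
    by (rule enumerated_pair_speedup[OF \<sigma>])
  have kept: "Q.kept n q \<longleftrightarrow> kept (\<sigma> n) q" for n q
    by (simp add: Q.kept_def kept_def)
  have "Q.doomed A (max c c')"
    unfolding Q.doomed_def kept max.bounded_iff using dA by blast
  \<comment> \<open>Since \<open>n \<le> \<sigma> n\<close>, a number present at stage
    \<open>n\<close> is present at stage \<open>\<sigma> n\<close> of the original
    enumeration.\<close>
  moreover have "Q.doomed B (max c c')"
    unfolding Q.doomed_def kept
  proof (intro allI impI)
    fix n q r
    assume "max c c' \<le> q" "q < r" "r \<le> n" "kept (\<sigma> n) q" "r \<in> R"
    moreover from this have "r \<le> \<sigma> n" using \<sigma>(3) order_trans by blast
    ultimately show "q \<notin> B"
      using doomed unfolding doomed_def max.bounded_iff by blast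
  qed
  ultimately show False
    using Q.splittable_if_doomed inf ns by blast
qed

end

theorem theorem9: "\<not> (\<exists>A B :: nat set. super_maximal_pair A B)"
proof
  assume "\<exists>A B :: nat set. super_maximal_pair A B"
  then obtain A B where AB: "super_maximal_pair A B" by blast
  then have "computably_enumerable A" "computably_enumerable B"
    by (simp_all add: super_maximal_pair_def)
  then obtain \<alpha> \<beta> where enum: "enumeration A \<alpha>" "enumeration B \<beta>"
    using computably_enumerable_imp_enumeration by metis
  have ns: "\<not> splittable A B"
  proof
    assume "splittable A B"
    then obtain X where X: "of_ce_degree X" "A \<subseteq> X" "B \<subseteq> - X" "infinite (X - A)" "infinite (- X - B)"
      by (auto simp: splittable_def)
    then have "finite (sym_diff X A) \<or> finite (sym_diff (- X) B)"
      using AB by (auto simp: super_maximal_pair_def eq_star_def)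
    then show False using X by auto
  qed
  interpret P: enumerated_pair A B \<alpha> \<beta>
    using enum AB by unfold_locales (auto simp: super_maximal_pair_def)
  have inf: "infinite P.R" using AB by (simp add: super_maximal_pair_def P.R_def)
  obtain i s where i: "\<And>m. m \<ge> s \<Longrightarrow> i \<le> P.active m" "\<And>u. \<exists>m\<ge>u. P.active m = i"
    using P.active_recurrent[OF ns] by blast
  obtain \<sigma> c where \<sigma>: "computable_in {} \<sigma>" "mono \<sigma>" "\<And>n. n \<le> \<sigma> n"
    and d: "\<And>n q r. \<lbrakk>c \<le> q; q < r; r \<le> n; P.kept (\<sigma> n) q; r \<in> P.R\<rbrakk> \<Longrightarrow>
      q \<notin> (if even i then B else A)"
    using P.speedup[of s i, OF i] by blast
  interpret Q: enumerated_pair A B "\<lambda>n. \<alpha> (\<sigma> n)" "\<lambda>n. \<beta> (\<sigma> n)"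
    by (rule P.enumerated_pair_speedup[OF \<sigma>])
  \<comment> \<open>For odd \<open>i\<close> it is \<open>A\<close> that becomes doomed; exchanging
    the two sets reduces this to the case of \<open>B\<close>.\<close>
  interpret S: enumerated_pair B A "\<lambda>n. \<beta> (\<sigma> n)" "\<lambda>n. \<alpha> (\<sigma> n)"
    using Q.enum_A Q.enum_B Q.disjoint by unfold_locales auto
  have S: "S.R = P.R" by (auto simp: S.R_def P.R_def)
  have kept: "Q.kept n q \<longleftrightarrow> P.kept (\<sigma> n) q" "S.kept n q \<longleftrightarrow> P.kept (\<sigma> n) q" for n q
    by (auto simp: P.kept_def Q.kept_def S.kept_def)
  show False
  proof (cases "even i")
    case True
    then have "Q.doomed B c" unfolding Q.doomed_def kept using d by auto
    then show ?thesis using Q.splittable_if_doomed_B inf ns by blast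
  next
    case False
    then have "S.doomed A c" unfolding S.doomed_def kept S using d by auto
    then show ?thesis using S.splittable_if_doomed_B inf ns splittable_sym unfolding S by blast
  qed
qed

end
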